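(* Let $\alpha\in\{1,2\}$ and let $M_N$ be the random symmetric tridiagonal $N\times N$ matrix such that $\sqrt N M_N$ has diagonal entries $a_1,\dots,a_N$ and off-diagonal entries $b_1,\dots,b_{N-1}$ (in positions $(i,i+1)$ and $(i+1,i)$), all independent, with $a_i\sim\mathcal N(0,\alpha)$ and $b_i\sim\chi(2i/\alpha)/\sqrt{2/\alpha}$. Let $\lambda_1$ be the largest eigenvalue of $M_N$ and let $Y_N$ be the largest eigenvalue of the bottom-right minor (principal submatrix on the last $l$ rows and columns) of $M_N$ of size $l>2N^{1/3}\log^3N$. Then for any $K>0$, $$|\lambda_1-Y_N|=O_{\Pr}(N^{-K}).$$
   Context: $\chi(d)$ denotes the chi distribution with $d$ degrees of freedom. The eigenvalues of $M_N$ are distributed as those of scaled GUE ($\alpha=1$) or scaled GOE ($\alpha=2$). $X_N=O_{\Pr}(a_N)$ means $X_N/a_N$ is bounded in probability as $N\to\infty$. *)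

theory Defs
  imports "HOL-Probability.Probability" "Jordan_Normal_Form.Spectral_Radius"
    "Jordan_Normal_Form.DL_Submatrix"
begin

definition chi_density :: "real \<Rightarrow> real \<Rightarrow> real" where
  "chi_density d x =
     (if x \<le> 0 then 0
      else x powr (d - 1) * exp (- x\<^sup>2 / 2) / (2 powr (d / 2 - 1) * Gamma (d / 2)))"

definition chi_distribution :: "real \<Rightarrow> real measure" where
  "chi_distribution d = density lborel (\<lambda>x. ennreal (chi_density d x))"

(* Matrix indices start at 0, the sequences a and b at 1: in 1-based terms the diagonal is
   a 1, ..., a n, and b i (for i = 1, ..., n-1) sits in positions (i,i+1) and (i+1,i). *)
definition sym_tridiag_mat :: "nat \<Rightarrow> (nat \<Rightarrow> real) \<Rightarrow> (nat \<Rightarrow> real) \<Rightarrow> real mat" where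
  "sym_tridiag_mat n a b = mat n n (\<lambda>(i, j).
     if i = j then a (i + 1)
     else if j = i + 1 then b (i + 1)
     else if i = j + 1 then b (j + 1)
     else 0)"

definition largest_eigenvalue :: "real mat \<Rightarrow> real" where
  "largest_eigenvalue A = Max (spectrum A)"

definition bottom_right_minor :: "nat \<Rightarrow> real mat \<Rightarrow> real mat" where
  "bottom_right_minor l A =
     submatrix A {dim_row A - l..<dim_row A} {dim_col A - l..<dim_col A}"

(* X N = O_Pr(c N): X N / c N is bounded in probability as N tends to infinity.  The N-th
   variable may live on its own probability space P N, as only its law matters. *)
definition bigo_in_prob ::
    "(nat \<Rightarrow> 'w measure) \<Rightarrow> (nat \<Rightarrow> 'w \<Rightarrow> real) \<Rightarrow> (nat \<Rightarrow> real) \<Rightarrow> bool" where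
  "bigo_in_prob P X c \<longleftrightarrow>
     (\<forall>\<epsilon>>0. \<exists>C. \<forall>\<^sub>F N in sequentially.
        measure (P N) {\<omega> \<in> space (P N). \<bar>X N \<omega> / c N\<bar> > C} < \<epsilon>)"

end

theory Submission
  imports Defs "HOL-Real_Asymp.Real_Asymp"
begin

text \<open>
  Write \<open>A i\<close> and \<open>B i\<close> for the diagonal and off-diagonal entries after division by \<open>\<surd>N\<close>, \<open>lam\<close>
  for the largest eigenvalue, \<open>v\<close> for its eigenvector, \<open>Y\<close> for the largest eigenvalue of the minor
  and \<open>d = N - l\<close>. Let \<open>L = ln N\<close> and \<open>s = N powr (1 / 3)\<close>.

  Using the last \<open>l\<close> entries of \<open>v\<close> as a trial vector for the minor costs one boundary term only
  (\<open>trailing_gap_times_mass_le\<close>), so \<open>lam - Y\<close> is at most \<open>B d * v d * v (d + 1)\<close> divided by the sum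
  of \<open>(v i)\<^sup>2\<close> over \<open>i > d\<close>. It is therefore enough that \<open>v\<close> grows superpolynomially between \<open>d\<close> and
  some later index. The ratios \<open>B i * v (i + 1) / v i\<close> obey a monotone Riccati recursion, and any
  positive \<open>\<rho>\<close> with \<open>\<rho> i + (B (i - 1))\<^sup>2 / \<rho> (i - 1) \<le> lam - A i\<close> is a lower bound for them
  (\<open>riccati_comparison\<close>, \<open>trailing_gap_le_geometric\<close>).

  With \<open>\<rho> = 1 + x\<close> and \<open>(B i)\<^sup>2 = i / N + f i\<close> the condition on \<open>x\<close> reads, up to smaller terms,
  that \<open>x i - x (i - 1) + (x (i - 1))\<^sup>2\<close> plus the noise \<open>A i + f (i - 1)\<close> plus \<open>2 - lam\<close> does not
  exceed \<open>(N - i) / N\<close>. At distance \<open>s * L ^ 3\<close> from the last index the right-hand side is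
  \<open>L ^ 3 / s\<^sup>2\<close>, whereas a single noise term is of order \<open>N powr (- 1 / 2)\<close> and cannot be dominated
  pointwise. Instead \<open>x\<close> cancels it: \<open>x i\<close> is the constant \<open>20 L / s\<close> plus the average, over a
  window of about \<open>s\<close> steps, of the noise sums that start after \<open>i\<close>. Its increments are minus the
  noise up to a drift of order \<open>L / s\<^sup>2\<close>, and \<open>x\<close> itself is of order \<open>L / s\<close>, so that
  \<open>x\<^sup>2\<close> is of order \<open>L\<^sup>2 / s\<^sup>2\<close>. A tent function of width about \<open>s\<close> as trial vector gives
  \<open>lam \<ge> 2 - L\<^sup>2 / s\<^sup>2\<close> (\<open>largest_eigenvalue_ge_tent\<close>). All losses are thus beaten by
  \<open>L ^ 3 / s\<^sup>2\<close>, and growth by \<open>1 + L / s\<close> along at least \<open>s * L ^ 3\<close> steps yields a gap of at most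
  \<open>2 * exp (- (L ^ 4) / 2)\<close> (\<open>trailing_gap_of_good_noise\<close>), which is eventually below every power of
  \<open>1 / N\<close>.

  Randomness enters only through the requirement that all interval sums of the \<open>a i\<close> and of the
  \<open>((b i)\<^sup>2 - i) / \<surd>N\<close> are at most \<open>3 L\<close> times the square root of the length of the interval. This
  holds with probability tending to \<open>1\<close> by a Chernoff bound and a union bound over all intervals
  (\<open>noise_event\<close>). Working with the squares of the off-diagonal entries, only the moment generating
  function of a chi-square variable is needed, which comes from rescaling the chi density.
\<close>

(* The scalar product and component symbols are reserved for vectors of variable dimension, as
   opposed to Euclidean spaces given by types. *)
unbundle no inner_syntax
unbundle no vec_syntax

section \<open>Rayleigh quotients of real symmetric matrices\<close>

lemma abs_quadratic_form_le:
  fixes D :: "real mat"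
  assumes D: "D \<in> carrier_mat n n" and x: "x \<in> carrier_vec n"
  shows "\<bar>x \<bullet> (D *\<^sub>v x)\<bar> \<le> (\<Sum>i<n. \<Sum>j<n. \<bar>D $$ (i, j)\<bar>) * (x \<bullet> x)"
proof -
  have le: "\<bar>x $ i * x $ j\<bar> \<le> x \<bullet> x" if "i < n" "j < n" for i j
  proof -
    have sq: "x $ k * x $ k \<le> x \<bullet> x" if "k < n" for k
      unfolding scalar_prod_def using x that
      by (intro member_le_sum) auto
    have "0 \<le> (\<bar>x $ i\<bar> - \<bar>x $ j\<bar>)\<^sup>2" by simp
    hence "2 * \<bar>x $ i * x $ j\<bar> \<le> x $ i * x $ i + x $ j * x $ j"
      by (simp add: power2_eq_square algebra_simps abs_mult)
    with sq[OF that(1)] sq[OF that(2)] show ?thesis by linarith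
  qed
  have "x \<bullet> (D *\<^sub>v x) = (\<Sum>i<n. \<Sum>j<n. D $$ (i, j) * (x $ i * x $ j))"
    using D x by (simp add: scalar_prod_def atLeast0LessThan sum_distrib_left mult_ac)
  hence "\<bar>x \<bullet> (D *\<^sub>v x)\<bar> \<le> (\<Sum>i<n. \<bar>\<Sum>j<n. D $$ (i, j) * (x $ i * x $ j)\<bar>)"
    by (simp add: sum_abs)
  also have "\<dots> \<le> (\<Sum>i<n. \<Sum>j<n. \<bar>D $$ (i, j) * (x $ i * x $ j)\<bar>)"
    by (intro sum_mono sum_abs)
  also have "\<dots> \<le> (\<Sum>i<n. \<Sum>j<n. \<bar>D $$ (i, j)\<bar> * (x \<bullet> x))"
    using le by (intro sum_mono) (auto simp only: abs_mult[of "_ $$ _"] lessThan_iff intro!: mult_left_mono)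
  also have "\<dots> = (\<Sum>i<n. \<Sum>j<n. \<bar>D $$ (i, j)\<bar>) * (x \<bullet> x)"
    by (simp add: sum_distrib_right)
  finally show ?thesis .
qed

text \<open>A positive semidefinite form with an invertible matrix is bounded below by a multiple of the
  squared norm. With \<open>y = D x\<close>, so that \<open>C y = x\<close>, the inequality follows by expanding the form at
  \<open>d x - y\<close>; no compactness is needed.\<close>

lemma psd_invertible_coercive:
  fixes C D :: "real mat"
  assumes C: "C \<in> carrier_mat n n" and D: "D \<in> carrier_mat n n" and CD: "C * D = 1\<^sub>m n"
    and sym: "transpose_mat C = C"
    and psd: "\<And>y. y \<in> carrier_vec n \<Longrightarrow> 0 \<le> y \<bullet> (C *\<^sub>v y)"
  obtains d where "d > 0" "\<And>x. x \<in> carrier_vec n \<Longrightarrow> x \<bullet> x \<le> d * (x \<bullet> (C *\<^sub>v x))"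
proof -
  define d where "d = 1 + (\<Sum>i<n. \<Sum>j<n. \<bar>D $$ (i, j)\<bar>)"
  have d: "d > 0" unfolding d_def by (intro add_pos_nonneg sum_nonneg) auto
  have "x \<bullet> x \<le> d * (x \<bullet> (C *\<^sub>v x))" if x: "x \<in> carrier_vec n" for x
  proof -
    define y where "y = D *\<^sub>v x"
    have y: "y \<in> carrier_vec n" unfolding y_def using D x by simp
    have Cy: "C *\<^sub>v y = x" unfolding y_def
      using assoc_mult_mat_vec[OF C D x] CD x by simp
    have yCx: "y \<bullet> (C *\<^sub>v x) = x \<bullet> x"
    proof -
      have "y \<bullet> (C *\<^sub>v x) = (transpose_mat C *\<^sub>v y) \<bullet> x"
        using transpose_vec_mult_scalar[OF C x y] by simp
      thus ?thesis using sym Cy by simp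
    qed
    have xx: "0 \<le> x \<bullet> x" unfolding scalar_prod_def by (intro sum_nonneg) auto
    have "x \<bullet> y \<le> d * (x \<bullet> x)"
    proof -
      have "x \<bullet> y \<le> (d - 1) * (x \<bullet> x)"
        using abs_quadratic_form_le[OF D x] unfolding y_def d_def by simp
      thus ?thesis using xx by (simp add: algebra_simps)
    qed
    have "0 \<le> (d \<cdot>\<^sub>v x - y) \<bullet> (C *\<^sub>v (d \<cdot>\<^sub>v x - y))"
      using x y by (intro psd) auto
    also have "C *\<^sub>v (d \<cdot>\<^sub>v x - y) = d \<cdot>\<^sub>v (C *\<^sub>v x) - x"
      using x y C Cy by (simp add: mult_minus_distrib_mat_vec mult_mat_vec)
    also have "(d \<cdot>\<^sub>v x - y) \<bullet> (d \<cdot>\<^sub>v (C *\<^sub>v x) - x)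
        = d * d * (x \<bullet> (C *\<^sub>v x)) - 2 * d * (x \<bullet> x) + x \<bullet> y"
    proof -
      have Cx: "C *\<^sub>v x \<in> carrier_vec n" using C x by simp
      have "(d \<cdot>\<^sub>v x - y) \<bullet> (d \<cdot>\<^sub>v (C *\<^sub>v x) - x)
         = (d \<cdot>\<^sub>v x) \<bullet> (d \<cdot>\<^sub>v (C *\<^sub>v x)) - (d \<cdot>\<^sub>v x) \<bullet> x - (y \<bullet> (d \<cdot>\<^sub>v (C *\<^sub>v x)) - y \<bullet> x)"
        using x y Cx by (simp add: minus_scalar_prod_distrib[of _ n] scalar_prod_minus_distrib[of _ n])
      also have "\<dots> = d * d * (x \<bullet> (C *\<^sub>v x)) - 2 * d * (x \<bullet> x) + x \<bullet> y"
        using x y Cx yCx comm_scalar_prod[OF x y] by simp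
      finally show ?thesis .
    qed
    finally have "0 \<le> d * d * (x \<bullet> (C *\<^sub>v x)) - 2 * d * (x \<bullet> x) + x \<bullet> y" .
    with \<open>x \<bullet> y \<le> d * (x \<bullet> x)\<close>
    have "d * (x \<bullet> x) \<le> d * (d * (x \<bullet> (C *\<^sub>v x)))" by (simp add: algebra_simps)
    thus ?thesis using d by simp
  qed
  with d that show ?thesis by blast
qed

text \<open>The supremum \<open>m\<close> of the Rayleigh quotients is an eigenvalue: otherwise \<open>m - A\<close> is positive
  semidefinite and invertible, hence coercive by the preceding lemma, and \<open>m\<close> could be lowered.\<close>

lemma
  fixes A :: "real mat"
  assumes A: "A \<in> carrier_mat n n" and sym: "transpose_mat A = A" and n: "n > 0"
  shows eigenvalue_largest_eigenvalue: "eigenvalue A (largest_eigenvalue A)"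
    and rayleigh_le_largest_eigenvalue:
      "\<And>x. x \<in> carrier_vec n \<Longrightarrow> x \<bullet> (A *\<^sub>v x) \<le> largest_eigenvalue A * (x \<bullet> x)"
proof -
  define R where "R = (\<lambda>x. x \<bullet> (A *\<^sub>v x) / (x \<bullet> x)) ` (carrier_vec n - {0\<^sub>v n})"
  define m where "m = Sup R"
  have pos: "0 < x \<bullet> x" if "x \<in> carrier_vec n" "x \<noteq> 0\<^sub>v n" for x :: "real vec"
  proof -
    have "\<exists>i<n. x $ i \<noteq> 0"
    proof (rule ccontr)
      assume "\<not> (\<exists>i<n. x $ i \<noteq> 0)"
      hence "x = 0\<^sub>v n" using that(1) by (intro eq_vecI) auto
      with that(2) show False by simp
    qed
    then obtain i where i: "i < n" "x $ i \<noteq> 0" by blast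
    have "0 < x $ i * x $ i" using i by (auto simp: zero_less_mult_iff)
    also have "\<dots> \<le> x \<bullet> x" unfolding scalar_prod_def using i that
      by (intro member_le_sum) auto
    finally show ?thesis .
  qed
  have ne: "R \<noteq> {}"
  proof -
    have "unit_vec n 0 $ 0 \<noteq> (0\<^sub>v n :: real vec) $ 0" using n by simp
    hence "unit_vec n 0 \<in> carrier_vec n - {0\<^sub>v n :: real vec}" by auto
    thus ?thesis unfolding R_def by blast
  qed
  have bdd: "bdd_above R"
  proof (rule bdd_aboveI)
    fix r assume "r \<in> R"
    then obtain x where x: "x \<in> carrier_vec n" "x \<noteq> 0\<^sub>v n" and r: "r = x \<bullet> (A *\<^sub>v x) / (x \<bullet> x)"
      unfolding R_def by auto
    show "r \<le> (\<Sum>i<n. \<Sum>j<n. \<bar>A $$ (i, j)\<bar>)"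
      using abs_quadratic_form_le[OF A x(1)] pos[OF x] unfolding r
      by (simp add: divide_le_eq)
  qed
  have le_m: "x \<bullet> (A *\<^sub>v x) \<le> m * (x \<bullet> x)" if x: "x \<in> carrier_vec n" for x
  proof (cases "x = 0\<^sub>v n")
    case True thus ?thesis using A by simp
  next
    case False
    have "x \<bullet> (A *\<^sub>v x) / (x \<bullet> x) \<le> m" unfolding m_def
      using x False by (intro cSup_upper bdd) (auto simp: R_def)
    thus ?thesis using pos[OF x False] by (simp add: divide_le_eq)
  qed
  have ev_m: "eigenvalue A m"
  proof (rule ccontr)
    assume "\<not> eigenvalue A m"
    define C where "C = - char_matrix A m"
    have C: "C \<in> carrier_mat n n" unfolding C_def using A by simp
    have "char_matrix A m \<in> Units (ring_mat TYPE(real) n ())"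
      using \<open>\<not> eigenvalue A m\<close> A eigenvalue_det[OF A] by (intro det_non_zero_imp_unit) auto
    then obtain E where E: "E \<in> carrier_mat n n" "char_matrix A m * E = 1\<^sub>m n"
      unfolding Units_def ring_mat_def by auto
    have CE: "C * (- E) = 1\<^sub>m n"
      unfolding C_def using carrier_matD[OF E(1)] carrier_matD[OF char_matrix_closed[OF A]] E(2)
      by (subst uminus_mult_right_mat; simp)
    have Cx: "C *\<^sub>v x = m \<cdot>\<^sub>v x - A *\<^sub>v x" if x: "x \<in> carrier_vec n" for x
    proof
      show "dim_vec (C *\<^sub>v x) = dim_vec (m \<cdot>\<^sub>v x - A *\<^sub>v x)" using A C by simp
      fix i assume "i < dim_vec (m \<cdot>\<^sub>v x - A *\<^sub>v x)"
      hence i: "i < n" using A by simp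
      have "- (\<Sum>j<n. (A $$ (i, j) - m * (if j = i then 1 else 0)) * x $ j)
         = (\<Sum>j<n. (if j = i then m * x $ j else 0)) - (\<Sum>j<n. A $$ (i, j) * x $ j)"
        unfolding sum_subtractf[symmetric] sum_negf[symmetric]
        by (intro sum.cong) (auto simp: algebra_simps)
      thus "(C *\<^sub>v x) $ i = (m \<cdot>\<^sub>v x - A *\<^sub>v x) $ i"
        using A x i unfolding C_def char_matrix_def
        by (simp add: scalar_prod_def atLeast0LessThan)
    qed
    have symC: "transpose_mat C = C"
    proof
      fix i j assume "i < dim_row C" "j < dim_col C"
      hence ij: "i < n" "j < n" using C by auto
      have "A $$ (j, i) = A $$ (i, j)" using sym A ij by (metis carrier_matD index_transpose_mat(1))
      thus "transpose_mat C $$ (i, j) = C $$ (i, j)"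
        using A ij unfolding C_def char_matrix_def by simp
    qed (use C in auto)
    have form: "x \<bullet> (C *\<^sub>v x) = m * (x \<bullet> x) - x \<bullet> (A *\<^sub>v x)" if x: "x \<in> carrier_vec n" for x
      using x A by (simp add: Cx scalar_prod_minus_distrib[of _ n])
    have "0 \<le> x \<bullet> (C *\<^sub>v x)" if "x \<in> carrier_vec n" for x
      using le_m[OF that] form[OF that] by simp
    from psd_invertible_coercive[OF C _ CE symC this] E(1)
    obtain d where d: "d > 0" "\<And>x. x \<in> carrier_vec n \<Longrightarrow> x \<bullet> x \<le> d * (x \<bullet> (C *\<^sub>v x))"
      by auto
    have "m \<le> m - 1 / d"
      unfolding m_def
    proof (rule cSup_least[OF ne])
      fix r assume "r \<in> R"
      then obtain x where x: "x \<in> carrier_vec n" "x \<noteq> 0\<^sub>v n" and r: "r = x \<bullet> (A *\<^sub>v x) / (x \<bullet> x)"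
        unfolding R_def by auto
      have "x \<bullet> x / d \<le> m * (x \<bullet> x) - x \<bullet> (A *\<^sub>v x)"
        using d(2)[OF x(1)] form[OF x(1)] d(1) by (simp add: divide_le_eq mult.commute)
      hence "x \<bullet> (A *\<^sub>v x) \<le> (m - 1 / d) * (x \<bullet> x)" by (simp add: algebra_simps)
      thus "r \<le> Sup R - 1 / d" using pos[OF x] unfolding r m_def by (simp add: divide_le_eq)
    qed
    thus False using d(1) by simp
  qed
  have "largest_eigenvalue A = m"
    unfolding largest_eigenvalue_def
  proof (rule Max_eqI)
    show "finite (spectrum A)" using card_finite_spectrum(1)[OF A] .
    show "m \<in> spectrum A" using ev_m unfolding spectrum_def by simp
    fix e assume "e \<in> spectrum A"
    then obtain v where v: "v \<in> carrier_vec n" "v \<noteq> 0\<^sub>v n" "A *\<^sub>v v = e \<cdot>\<^sub>v v"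
      unfolding spectrum_def eigenvalue_def eigenvector_def using A by auto
    have "e * (v \<bullet> v) \<le> m * (v \<bullet> v)" using le_m[OF v(1)] v by simp
    thus "e \<le> m" using pos[OF v(1,2)] by simp
  qed
  with ev_m le_m show "eigenvalue A (largest_eigenvalue A)"
    and "\<And>x. x \<in> carrier_vec n \<Longrightarrow> x \<bullet> (A *\<^sub>v x) \<le> largest_eigenvalue A * (x \<bullet> x)"
    by auto
qed

section \<open>Symmetric tridiagonal matrices as Jacobi operators\<close>

text \<open>The three-term operator on sequences that belongs to a symmetric tridiagonal matrix with diagonal
  \<open>A\<close> and off-diagonal \<open>B\<close>. A vector of length \<open>n\<close> is encoded as a sequence on the indices
  \<open>1, ..., n\<close>; the boundary conditions \<open>w 0 = 0\<close> and \<open>w (n + 1) = 0\<close> stand for the missing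
  neighbours, and make the values \<open>B 0\<close> and \<open>B n\<close> irrelevant.\<close>

definition jacobi :: "(nat \<Rightarrow> real) \<Rightarrow> (nat \<Rightarrow> real) \<Rightarrow> (nat \<Rightarrow> real) \<Rightarrow> nat \<Rightarrow> real" where
  "jacobi A B w i = B (i - 1) * w (i - 1) + A i * w i + B i * w (i + 1)"

lemma sym_tridiag_mat_carrier [simp]: "sym_tridiag_mat n A B \<in> carrier_mat n n"
  unfolding sym_tridiag_mat_def by simp

lemma transpose_sym_tridiag_mat: "transpose_mat (sym_tridiag_mat n A B) = sym_tridiag_mat n A B"
  unfolding sym_tridiag_mat_def by (intro eq_matI) auto

lemma smult_sym_tridiag_mat:
  "c \<cdot>\<^sub>m sym_tridiag_mat n A B = sym_tridiag_mat n (\<lambda>i. c * A i) (\<lambda>i. c * B i)"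
  unfolding sym_tridiag_mat_def by (intro eq_matI) auto

lemma sym_tridiag_mat_cong:
  assumes "\<And>i. i \<in> {1..n} \<Longrightarrow> A i = A' i" "\<And>i. i \<in> {1..<n} \<Longrightarrow> B i = B' i"
  shows "sym_tridiag_mat n A B = sym_tridiag_mat n A' B'"
  unfolding sym_tridiag_mat_def using assms by (intro eq_matI) auto

lemma pick_atLeastLessThan: "i < n - m \<Longrightarrow> pick {m..<n} i = m + i"
proof (induction i)
  case 0
  thus ?case by (auto intro!: Least_equality)
next
  case (Suc i)
  thus ?case by (auto intro!: Least_equality)
qed

lemma bottom_right_minor_sym_tridiag_mat:
  assumes "l \<le> n"
  shows "bottom_right_minor l (sym_tridiag_mat n A B)
    = sym_tridiag_mat l (\<lambda>i. A (i + (n - l))) (\<lambda>i. B (i + (n - l)))"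
proof -
  define d where "d = n - l"
  have n: "n = d + l" unfolding d_def using assms by simp
  have "{i. i < n \<and> i \<in> {d..<n}} = {d..<n}" by auto
  hence c: "card {i. i < n \<and> i \<in> {d..<n}} = l" using n by simp
  have dim: "dim_row (sym_tridiag_mat n A B) = n" "dim_col (sym_tridiag_mat n A B) = n"
    unfolding sym_tridiag_mat_def by auto
  show ?thesis
    unfolding bottom_right_minor_def submatrix_def dim d_def[symmetric] c
  proof (rule eq_matI)
    fix i j
    assume "i < dim_row (sym_tridiag_mat l (\<lambda>i. A (i + d)) (\<lambda>i. B (i + d)))"
      and "j < dim_col (sym_tridiag_mat l (\<lambda>i. A (i + d)) (\<lambda>i. B (i + d)))"
    hence ij: "i < l" "j < l" unfolding sym_tridiag_mat_def by auto
    have p: "pick {d..<n} i = i + d" "pick {d..<n} j = j + d"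
      using pick_atLeastLessThan[of i n d] pick_atLeastLessThan[of j n d] ij n by auto
    show "mat l l (\<lambda>(i, j). sym_tridiag_mat n A B $$ (pick {d..<n} i, pick {d..<n} j)) $$ (i, j)
        = sym_tridiag_mat l (\<lambda>i. A (i + d)) (\<lambda>i. B (i + d)) $$ (i, j)"
      unfolding index_mat(1)[OF ij] split_conv p using ij n by (simp add: sym_tridiag_mat_def)
  qed (auto simp: sym_tridiag_mat_def)
qed

lemma sym_tridiag_mat_mult_vec:
  assumes w: "w 0 = 0" "w (n + 1) = 0" and k: "k < n"
  shows "(sym_tridiag_mat n A B *\<^sub>v vec n (\<lambda>i. w (i + 1))) $ k = jacobi A B w (k + 1)"
proof -
  have "(sym_tridiag_mat n A B *\<^sub>v vec n (\<lambda>i. w (i + 1))) $ k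
      = (\<Sum>j<n. (if k = j then A (k + 1) else if j = k + 1 then B (k + 1)
             else if k = j + 1 then B (j + 1) else 0) * w (j + 1))"
    using k unfolding sym_tridiag_mat_def by (simp add: scalar_prod_def atLeast0LessThan)
  also have "\<dots> = (\<Sum>j<n. (if j = k then A (k + 1) * w (k + 1) else 0)
       + (if j = k + 1 then B (k + 1) * w (k + 2) else 0)
       + (if j = k - 1 then (if k = 0 then 0 else B k * w k) else 0))"
    by (intro sum.cong) auto
  also have "\<dots> = A (k + 1) * w (k + 1) + (if k + 1 < n then B (k + 1) * w (k + 2) else 0)
       + (if k = 0 then 0 else B k * w k)"
    using k by (simp add: sum.distrib)
  also have "\<dots> = jacobi A B w (k + 1)"
  proof -
    have "w (k + 2) = 0" if "\<not> k + 1 < n"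
    proof -
      have "k + 2 = n + 1" using that k by simp
      thus ?thesis using w(2) by simp
    qed
    thus ?thesis unfolding jacobi_def using w(1) by auto
  qed
  finally show ?thesis .
qed

lemma rayleigh_sym_tridiag_mat:
  assumes n: "n > 0" and w: "w 0 = 0" "w (n + 1) = 0"
  shows "(\<Sum>i = 1..n. w i * jacobi A B w i)
      \<le> largest_eigenvalue (sym_tridiag_mat n A B) * (\<Sum>i = 1..n. (w i)\<^sup>2)"
proof -
  define x where "x = vec n (\<lambda>i. w (i + 1))"
  have idx: "(\<Sum>i<n. g (i + 1)) = (\<Sum>i = 1..n. g i)" for g :: "nat \<Rightarrow> real"
    by (rule sum.reindex_bij_witness[of _ "\<lambda>i. i - 1" "\<lambda>i. i + 1"]) auto
  have x: "x \<in> carrier_vec n" unfolding x_def by simp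
  have "x \<bullet> (sym_tridiag_mat n A B *\<^sub>v x)
      = (\<Sum>k<n. x $ k * (sym_tridiag_mat n A B *\<^sub>v x) $ k)"
    unfolding scalar_prod_def[of x] by (simp add: atLeast0LessThan carrier_matD[OF sym_tridiag_mat_carrier])
  also have "\<dots> = (\<Sum>k<n. w (k + 1) * jacobi A B w (k + 1))"
    using sym_tridiag_mat_mult_vec[OF w] by (intro sum.cong) (auto simp: x_def)
  also have "\<dots> = (\<Sum>i = 1..n. w i * jacobi A B w i)"
    by (rule idx)
  finally have 1: "x \<bullet> (sym_tridiag_mat n A B *\<^sub>v x) = (\<Sum>i = 1..n. w i * jacobi A B w i)" .
  have "x \<bullet> x = (\<Sum>k<n. (w (k + 1))\<^sup>2)"
    unfolding x_def by (simp add: scalar_prod_def atLeast0LessThan power2_eq_square)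
  also have "\<dots> = (\<Sum>i = 1..n. (w i)\<^sup>2)" by (rule idx)
  finally have 2: "x \<bullet> x = (\<Sum>i = 1..n. (w i)\<^sup>2)" .
  from rayleigh_le_largest_eigenvalue[OF sym_tridiag_mat_carrier transpose_sym_tridiag_mat n x, of A B]
  show ?thesis unfolding 1 2 .
qed

lemma eigenvector_sym_tridiag_mat:
  assumes n: "n > 0"
  obtains v where "v 0 = 0" "v (n + 1) = 0" "\<exists>i\<in>{1..n}. v i \<noteq> 0"
    "\<And>i. i \<in> {1..n} \<Longrightarrow> jacobi A B v i = largest_eigenvalue (sym_tridiag_mat n A B) * v i"
proof -
  define T where "T = sym_tridiag_mat n A B"
  have T: "T \<in> carrier_mat n n" unfolding T_def by simp
  from eigenvalue_largest_eigenvalue[OF sym_tridiag_mat_carrier transpose_sym_tridiag_mat n, of A B]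
  obtain x where x: "x \<in> carrier_vec n" "x \<noteq> 0\<^sub>v n" "T *\<^sub>v x = largest_eigenvalue T \<cdot>\<^sub>v x"
    unfolding T_def[symmetric] eigenvalue_def eigenvector_def using T by auto
  define v where "v i = (if i \<in> {1..n} then x $ (i - 1) else 0)" for i
  have v: "v 0 = 0" "v (n + 1) = 0" unfolding v_def by auto
  have xv: "vec n (\<lambda>i. v (i + 1)) = x"
    using x(1) by (intro eq_vecI) (auto simp: v_def)
  have "jacobi A B v i = largest_eigenvalue T * v i" if i: "i \<in> {1..n}" for i
  proof -
    obtain k where k: "i = k + 1" "k < n" using i by (cases i) auto
    have "jacobi A B v i = (T *\<^sub>v x) $ (i - 1)"
      using sym_tridiag_mat_mult_vec[OF v k(2), of A B] unfolding xv T_def k by simp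
    also have "\<dots> = largest_eigenvalue T * x $ (i - 1)" unfolding x(3) using x(1) i by auto
    finally show ?thesis using i by (simp add: v_def)
  qed
  moreover have "\<exists>i\<in>{1..n}. v i \<noteq> 0"
  proof (rule ccontr)
    assume "\<not> ?thesis"
    hence "x $ k = 0" if "k < n" for k using that by (auto simp: v_def dest!: bspec[of _ _ "k + 1"])
    hence "x = 0\<^sub>v n" using x(1) by (intro eq_vecI) auto
    with x(2) show False by simp
  qed
  ultimately show ?thesis using that v unfolding T_def by blast
qed

section \<open>The gap to a trailing minor and the growth of the eigenvector\<close>

lemma sum_split_offset:
  fixes g :: "nat \<Rightarrow> real"
  shows "(\<Sum>i = 1..d + l. g i) = (\<Sum>i = 1..d. g i) + (\<Sum>j = 1..l. g (j + d))"
proof -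
  have "(\<Sum>i = 1..d + l. g i) = (\<Sum>i = 1..d. g i) + (\<Sum>i = d + 1..d + l. g i)"
    by (rule sum.ub_add_nat) simp
  also have "(\<Sum>i = d + 1..d + l. g i) = (\<Sum>j = 1..l. g (j + d))"
    using sum.shift_bounds_cl_nat_ivl[of g 1 d l] by (simp add: add.commute)
  finally show ?thesis .
qed

text \<open>In this section \<open>d + l\<close> is the size of the matrix and \<open>l\<close> that of the trailing minor, whose
  entries are the original ones shifted by \<open>d\<close>. One half of the comparison is immediate: an
  eigenvector of the minor, extended by zero, is a trial vector for the whole matrix.\<close>

lemma trailing_largest_eigenvalue_le:
  assumes "l > 0"
  shows "largest_eigenvalue (sym_tridiag_mat l (\<lambda>i. A (i + d)) (\<lambda>i. B (i + d)))
      \<le> largest_eigenvalue (sym_tridiag_mat (d + l) A B)" (is "?Y \<le> ?lam")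
proof -
  obtain u where u0: "u 0 = 0" "u (l + 1) = 0" and un: "\<exists>i\<in>{1..l}. u i \<noteq> 0"
    and u: "\<And>j. j \<in> {1..l} \<Longrightarrow> jacobi (\<lambda>i. A (i + d)) (\<lambda>i. B (i + d)) u j = ?Y * u j"
    using eigenvector_sym_tridiag_mat[OF assms, of "\<lambda>i. A (i + d)" "\<lambda>i. B (i + d)"] by blast
  define w where "w i = (if i > d then u (i - d) else 0)" for i
  have w: "w 0 = 0" "w (d + l + 1) = 0" using u0 by (auto simp: w_def)
  have shift: "w (j + d) = u j" for j using u0 by (auto simp: w_def)
  have jac: "jacobi A B w (j + d) = ?Y * u j" if j: "j \<in> {1..l}" for j
  proof -
    obtain k where k: "j = k + 1" using j by (cases j) auto
    have "jacobi A B w (j + d) = jacobi (\<lambda>i. A (i + d)) (\<lambda>i. B (i + d)) u j"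
      unfolding jacobi_def k w_def using u0(1) by simp
    thus ?thesis using u[OF j] by simp
  qed
  have w_le: "w i = 0" if "i \<in> {1..d}" for i using that by (auto simp: w_def)
  have "(\<Sum>i = 1..d + l. w i * jacobi A B w i) = (\<Sum>j = 1..l. w (j + d) * jacobi A B w (j + d))"
    unfolding sum_split_offset using w_le by (simp add: sum.neutral)
  also have "\<dots> = (\<Sum>j = 1..l. ?Y * (u j)\<^sup>2)"
    by (intro sum.cong refl) (simp only: jac shift, simp add: power2_eq_square)
  also have "\<dots> = ?Y * (\<Sum>j = 1..l. (u j)\<^sup>2)" by (simp add: sum_distrib_left)
  finally have 1: "(\<Sum>i = 1..d + l. w i * jacobi A B w i) = ?Y * (\<Sum>j = 1..l. (u j)\<^sup>2)" .
  have 2: "(\<Sum>i = 1..d + l. (w i)\<^sup>2) = (\<Sum>j = 1..l. (u j)\<^sup>2)"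
    unfolding sum_split_offset using w_le by (simp add: shift sum.neutral)
  have pos: "0 < (\<Sum>j = 1..l. (u j)\<^sup>2)"
  proof -
    obtain i where "i \<in> {1..l}" "u i \<noteq> 0" using un by blast
    thus ?thesis by (intro sum_pos2[of _ i]) auto
  qed
  have "?Y * (\<Sum>j = 1..l. (u j)\<^sup>2) \<le> ?lam * (\<Sum>j = 1..l. (u j)\<^sup>2)"
    using rayleigh_sym_tridiag_mat[OF _ w, of A B] assms unfolding 1 2 by simp
  thus ?thesis using pos by simp
qed

text \<open>Conversely, the last \<open>l\<close> entries of an eigenvector of the whole matrix form a trial vector for the
  minor; it satisfies the eigenvalue equation except for a single term at the cut.\<close>

lemma trailing_gap_times_mass_le:
  assumes "l > 0"
    and v: "v (d + l + 1) = 0"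
      "\<And>i. i \<in> {1..d + l} \<Longrightarrow> jacobi A B v i = lam * v i"
  shows "(lam - largest_eigenvalue (sym_tridiag_mat l (\<lambda>i. A (i + d)) (\<lambda>i. B (i + d))))
      * (\<Sum>j = 1..l. (v (j + d))\<^sup>2) \<le> B d * v d * v (d + 1)"
    (is "(lam - ?Y) * ?S \<le> _")
proof -
  define w where "w j = (if j = 0 then 0 else v (j + d))" for j
  have w: "w 0 = 0" "w (l + 1) = 0" using v(1) by (auto simp: w_def add_ac)
  have jac: "jacobi (\<lambda>i. A (i + d)) (\<lambda>i. B (i + d)) w j
      = lam * v (j + d) - (if j = 1 then B d * v d else 0)" if j: "j \<in> {1..l}" for j
  proof -
    obtain k where k: "j = k + 1" using j by (cases j) auto
    have "jacobi (\<lambda>i. A (i + d)) (\<lambda>i. B (i + d)) w j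
      = jacobi A B v (j + d) - (if j = 1 then B d * v d else 0)"
      unfolding jacobi_def k w_def by (simp add: ac_simps)
    thus ?thesis using v(2)[of "j + d"] j by simp
  qed
  have "(\<Sum>j = 1..l. w j * jacobi (\<lambda>i. A (i + d)) (\<lambda>i. B (i + d)) w j)
      = (\<Sum>j = 1..l. lam * (v (j + d))\<^sup>2 - (if j = 1 then B d * v d * v (d + 1) else 0))"
    by (intro sum.cong refl) (simp add: jac, simp add: w_def power2_eq_square algebra_simps)
  also have "\<dots> = lam * ?S - B d * v d * v (d + 1)"
    using assms(1) by (simp add: sum_subtractf sum_distrib_left)
  finally have 1: "(\<Sum>j = 1..l. w j * jacobi (\<lambda>i. A (i + d)) (\<lambda>i. B (i + d)) w j)
      = lam * ?S - B d * v d * v (d + 1)" .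
  have 2: "(\<Sum>j = 1..l. (w j)\<^sup>2) = ?S"
    by (intro sum.cong) (auto simp: w_def)
  have "lam * ?S - B d * v d * v (d + 1) \<le> ?Y * ?S"
    using rayleigh_sym_tridiag_mat[OF assms(1) w, of "\<lambda>i. A (i + d)" "\<lambda>i. B (i + d)"]
    unfolding 1 2 .
  thus ?thesis by (simp add: algebra_simps)
qed

text \<open>The ratios \<open>r i = B i * v (i + 1) / v i\<close> satisfy the Riccati recursion
  \<open>r i = lam - A i - (B (i - 1))\<^sup>2 / r (i - 1)\<close>, which is increasing in \<open>r (i - 1) > 0\<close>. Hence a positive
  \<open>\<rho>\<close> that satisfies the recursion with \<open>\<le>\<close> stays below \<open>r\<close>. Setting \<open>B 0 = 0\<close> lets the induction
  start at \<open>0\<close> without a condition on \<open>\<rho> 0\<close> beyond positivity.\<close>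

lemma riccati_comparison:
  assumes v: "v 0 = 0" "v 1 > 0"
      "\<And>i. i \<in> {1..n} \<Longrightarrow> jacobi A B v i = lam * v i"
    and B: "B 0 = 0"
    and \<rho>: "\<And>i. i \<le> I \<Longrightarrow> 0 < \<rho> i"
      "\<And>i. i \<in> {1..I} \<Longrightarrow> \<rho> i + (B (i - 1))\<^sup>2 / \<rho> (i - 1) \<le> lam - A i"
    and Bpos: "\<And>i. i \<in> {1..I} \<Longrightarrow> 0 < B i"
    and I: "I < n" and i: "i \<le> I"
  shows "\<rho> i * v i \<le> B i * v (i + 1) \<and> 0 < v (i + 1)"
  using i
proof (induction i)
  case 0
  show ?case using v(1,2) B by simp
next
  case (Suc i)
  hence IH: "\<rho> i * v i \<le> B i * v (i + 1)" "0 < v (i + 1)" by auto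
  have "B i \<ge> 0" using Bpos[of i] B Suc.prems by (cases "i = 0") auto
  have \<rho>i: "0 < \<rho> i" using \<rho>(1) Suc.prems by simp
  have "v i \<le> B i * v (i + 1) / \<rho> i" using IH(1) \<rho>i by (simp add: pos_le_divide_eq mult.commute)
  hence "B i * v i \<le> B i * (B i * v (i + 1) / \<rho> i)"
    using \<open>B i \<ge> 0\<close> by (rule mult_left_mono)
  hence 1: "B i * v i \<le> (B i)\<^sup>2 / \<rho> i * v (i + 1)" by (simp add: power2_eq_square)
  have "(\<rho> (i + 1) + (B i)\<^sup>2 / \<rho> i) * v (i + 1) \<le> (lam - A (i + 1)) * v (i + 1)"
    using \<rho>(2)[of "i + 1"] Suc.prems IH(2) by (intro mult_right_mono) auto
  moreover have "B (i + 1) * v (i + 2) = (lam - A (i + 1)) * v (i + 1) - B i * v i"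
    using v(3)[of "i + 1"] Suc.prems I unfolding jacobi_def by (simp add: algebra_simps)
  ultimately have 2: "\<rho> (i + 1) * v (i + 1) \<le> B (i + 1) * v (i + 2)"
    using 1 by (simp add: algebra_simps)
  have "0 < \<rho> (i + 1) * v (i + 1)" using \<rho>(1)[of "i + 1"] Suc.prems IH(2) by simp
  with 2 have "0 < B (i + 1) * v (i + 2)" by linarith
  hence "0 < v (i + 2)" using Bpos[of "i + 1"] Suc.prems by (simp add: zero_less_mult_iff)
  with 2 show ?case by simp
qed

text \<open>If \<open>\<rho>\<close> exceeds \<open>B\<close> by the factor \<open>1 + g\<close> up to the index \<open>I\<close>, then the eigenvector grows by
  this factor at each of the \<open>I + 1 - d\<close> steps from \<open>d\<close> to \<open>I + 1\<close>, and the mass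
  \<open>(v (I + 1))\<^sup>2\<close> alone dominates the term at the cut.\<close>

lemma trailing_gap_le_geometric:
  fixes g :: real
  assumes l: "l > 0" and d: "d \<le> I" and I: "I < d + l" and g: "g \<ge> 0"
    and lam: "lam = largest_eigenvalue (sym_tridiag_mat (d + l) A B)"
    and Y: "Y = largest_eigenvalue (sym_tridiag_mat l (\<lambda>i. A (i + d)) (\<lambda>i. B (i + d)))"
    and B: "B 0 = 0" "\<And>i. i \<in> {1..<d + l} \<Longrightarrow> 0 < B i"
    and \<rho>: "\<And>i. i \<le> I \<Longrightarrow> 0 < \<rho> i"
      "\<And>i. i \<in> {1..I} \<Longrightarrow> \<rho> i + (B (i - 1))\<^sup>2 / \<rho> (i - 1) \<le> lam - A i"
      "\<And>i. i \<le> I \<Longrightarrow> (1 + g) * B i \<le> \<rho> i"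
  shows "\<bar>lam - Y\<bar> \<le> B d / (1 + g) ^ (I + 1 - d)"
proof -
  define n where "n = d + l"
  have n: "n > 0" using l n_def by simp
  obtain v' where v': "v' 0 = 0" "v' (n + 1) = 0" "\<exists>i\<in>{1..n}. v' i \<noteq> 0"
    "\<And>i. i \<in> {1..n} \<Longrightarrow> jacobi A B v' i = lam * v' i"
    using eigenvector_sym_tridiag_mat[OF n] unfolding lam n_def by metis
  \<comment> \<open>the three-term recursion with positive \<open>B\<close> would propagate a zero at index 1 to all indices\<close>
  have "v' 1 \<noteq> 0"
  proof
    assume v1: "v' 1 = 0"
    have "v' i = 0 \<and> v' (i + 1) = 0" if "i < n" for i
      using that
    proof (induction i)
      case 0 thus ?case using v' v1 by simp
    next
      case (Suc i)
      hence IH: "v' i = 0" "v' (i + 1) = 0" by auto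
      have "B (i + 1) * v' (i + 2) = 0"
        using v'(4)[of "i + 1"] IH Suc.prems unfolding jacobi_def by simp
      moreover have "B (i + 1) > 0" using B(2)[of "i + 1"] Suc.prems n_def by simp
      ultimately show ?case using IH by simp
    qed
    hence "v' i = 0" if "i \<in> {1..n}" for i using that by (cases i) auto
    with v'(3) show False by blast
  qed
  define v where "v i = sgn (v' 1) * v' i" for i
  have v: "v 0 = 0" "v (n + 1) = 0" "v 1 > 0"
    using v' \<open>v' 1 \<noteq> 0\<close> by (auto simp: v_def sgn_if)
  have vjac: "jacobi A B v i = lam * v i" if "i \<in> {1..n}" for i
  proof -
    have "jacobi A B v i = sgn (v' 1) * jacobi A B v' i"
      unfolding jacobi_def v_def by (simp add: algebra_simps)
    thus ?thesis using v'(4)[OF that] by (simp add: v_def)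
  qed
  have cmp: "\<rho> i * v i \<le> B i * v (i + 1)" "0 < v (i + 1)" if "i \<le> I" for i
    using riccati_comparison[OF v(1,3) vjac B(1) \<rho>(1,2) _ _ that] B(2) I n_def by auto
  have grow: "(1 + g) * v i \<le> v (i + 1)" if i: "i \<le> I" for i
  proof (cases "i = 0")
    case True thus ?thesis using v by simp
  next
    case False
    have Bi: "B i > 0" using B(2) i I False by simp
    have vi: "0 < v i" using cmp(2)[of "i - 1"] i False by simp
    have "B i * ((1 + g) * v i) = ((1 + g) * B i) * v i" by simp
    also have "\<dots> \<le> \<rho> i * v i" using \<rho>(3)[OF i] vi by (intro mult_right_mono) auto
    also have "\<dots> \<le> B i * v (i + 1)" using cmp(1)[OF i] .
    finally show ?thesis using Bi by simp
  qed
  have nn: "0 \<le> v i" if "i \<le> I + 1" for i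
    using cmp(2)[of "i - 1"] that v(1) by (cases i) (auto intro: less_imp_le)
  have pw: "(1 + g) ^ k * v i \<le> v (i + k)" if "i + k \<le> I + 1" for i k
    using that
  proof (induction k)
    case (Suc k)
    have "(1 + g) ^ Suc k * v i = (1 + g) * ((1 + g) ^ k * v i)" by simp
    also have "\<dots> \<le> (1 + g) * v (i + k)" using Suc g by (intro mult_left_mono) auto
    also have "\<dots> \<le> v (i + k + 1)" using grow[of "i + k"] Suc.prems by simp
    finally show ?case by simp
  qed simp
  define q where "q = (1 + g) ^ (I + 1 - d)"
  have q: "q > 0" unfolding q_def using g by (intro zero_less_power) simp
  define V where "V = v (I + 1)"
  have V: "V > 0" unfolding V_def using cmp(2)[of I] by simp
  have vd: "v d \<le> V / q"
    using pw[of d "I + 1 - d"] d q unfolding q_def[symmetric] V_def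
    by (simp add: pos_le_divide_eq mult.commute)
  have vd1: "v (d + 1) \<le> V"
  proof -
    have "v (d + 1) \<le> (1 + g) ^ (I - d) * v (d + 1)"
      using nn[of "d + 1"] d g by (intro mult_le_cancel_right1[THEN iffD2]) (auto intro: one_le_power)
    also have "\<dots> \<le> V" using pw[of "d + 1" "I - d"] d unfolding V_def by simp
    finally show ?thesis .
  qed
  have Bd: "0 \<le> B d" using B d I by (cases "d = 0") (auto intro: less_imp_le)
  have le: "0 \<le> lam - Y" using trailing_largest_eigenvalue_le[OF l, of A d B] unfolding lam Y by simp
  have "V\<^sup>2 \<le> (\<Sum>j = 1..l. (v (j + d))\<^sup>2)"
  proof -
    have "(v (I + 1 - d + d))\<^sup>2 \<le> (\<Sum>j = 1..l. (v (j + d))\<^sup>2)"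
      using d I by (intro member_le_sum) auto
    thus ?thesis using d unfolding V_def by simp
  qed
  hence "(lam - Y) * V\<^sup>2 \<le> (lam - Y) * (\<Sum>j = 1..l. (v (j + d))\<^sup>2)"
    using le by (rule mult_left_mono)
  also have "\<dots> \<le> B d * v d * v (d + 1)"
    unfolding Y using v(2) vjac by (intro trailing_gap_times_mass_le[OF l]) (auto simp: n_def)
  also have "\<dots> \<le> B d * (V / q) * V"
  proof (rule mult_mono)
    show "B d * v d \<le> B d * (V / q)" using vd Bd by (rule mult_left_mono)
    show "0 \<le> B d * (V / q)" using Bd V q by simp
  qed (use vd1 nn[of "d + 1"] d in auto)
  finally have "(lam - Y) * V\<^sup>2 \<le> (B d / q) * V\<^sup>2" by (simp add: power2_eq_square)
  hence "lam - Y \<le> B d / q" by (rule mult_right_le_imp_le) (use V in simp)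
  thus ?thesis using le by (simp add: q_def)
qed

section \<open>A lower bound for the largest eigenvalue\<close>

lemma abs_sum_mult_le_by_parts:
  fixes z g :: "nat \<Rightarrow> real"
  assumes pq: "p \<le> q" and g: "g q = 0" and D: "D \<ge> 0"
    and M: "\<And>r. r \<in> {p..q} \<Longrightarrow> \<bar>\<Sum>i = p..<r. z i\<bar> \<le> M"
    and inc: "\<And>i. i \<in> {p..<q} \<Longrightarrow> \<bar>g (i + 1) - g i\<bar> \<le> D"
  shows "\<bar>\<Sum>i = p..<q. z i * g i\<bar> \<le> real (q - p) * D * M"
proof -
  define S where "S r = (\<Sum>i = p..<r. z i)" for r
  have "(\<Sum>i = p..<r. z i * g i) = S r * g r - (\<Sum>i = p..<r. S (i + 1) * (g (i + 1) - g i))"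
    if "p \<le> r" for r
    using that
  proof (induction r rule: dec_induct)
    case base
    thus ?case by (simp add: S_def)
  next
    case (step r)
    thus ?case by (simp add: S_def algebra_simps)
  qed
  from this[OF pq] have "\<bar>\<Sum>i = p..<q. z i * g i\<bar> = \<bar>\<Sum>i = p..<q. S (i + 1) * (g (i + 1) - g i)\<bar>"
    using g by simp
  also have "\<dots> \<le> (\<Sum>i = p..<q. \<bar>S (i + 1) * (g (i + 1) - g i)\<bar>)" by (rule sum_abs)
  also have "\<dots> \<le> (\<Sum>i = p..<q. M * D)"
  proof (rule sum_mono)
    fix i assume i: "i \<in> {p..<q}"
    have "\<bar>S (i + 1)\<bar> \<le> M" unfolding S_def using M[of "i + 1"] i by simp
    thus "\<bar>S (i + 1) * (g (i + 1) - g i)\<bar> \<le> M * D"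
      unfolding abs_mult using inc[OF i] by (intro mult_mono) auto
  qed
  finally show ?thesis by (simp add: mult_ac)
qed

text \<open>Every sum of \<open>z\<close> over an interval \<open>{p..<q}\<close> inside \<open>{m..<n}\<close> has the square-root size that is
  typical of independent centred summands, up to the factor \<open>\<sigma>\<close>. This is the only property of the
  noise that the deterministic part of the argument uses.\<close>

definition interval_sums_le :: "real \<Rightarrow> nat \<Rightarrow> nat \<Rightarrow> (nat \<Rightarrow> real) \<Rightarrow> bool" where
  "interval_sums_le \<sigma> m n z \<longleftrightarrow>
    (\<forall>p q. m \<le> p \<and> p \<le> q \<and> q \<le> n \<longrightarrow> \<bar>\<Sum>i = p..<q. z i\<bar> \<le> \<sigma> * sqrt (real (q - p)))"

lemma interval_sums_leD:
  "interval_sums_le \<sigma> m n z \<Longrightarrow> m \<le> p \<Longrightarrow> p \<le> q \<Longrightarrow> q \<le> n \<Longrightarrow>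
    \<bar>\<Sum>i = p..<q. z i\<bar> \<le> \<sigma> * sqrt (real (q - p))"
  unfolding interval_sums_le_def by blast

lemma interval_sums_le_cmult:
  assumes c: "0 \<le> c" and z: "interval_sums_le \<sigma> m n z"
  shows "interval_sums_le (c * \<sigma>) m n (\<lambda>i. c * z i)"
  unfolding interval_sums_le_def
proof (intro allI impI)
  fix p q assume "m \<le> p \<and> p \<le> q \<and> q \<le> n"
  hence "\<bar>\<Sum>i = p..<q. z i\<bar> \<le> \<sigma> * sqrt (real (q - p))" by (intro interval_sums_leD[OF z]) auto
  hence "c * \<bar>\<Sum>i = p..<q. z i\<bar> \<le> c * (\<sigma> * sqrt (real (q - p)))" using c by (rule mult_left_mono)
  thus "\<bar>\<Sum>i = p..<q. c * z i\<bar> \<le> c * \<sigma> * sqrt (real (q - p))"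
    using c by (simp add: sum_distrib_left[symmetric] abs_mult mult.assoc)
qed

lemma interval_sums_le_extend_zero:
  assumes \<sigma>: "0 \<le> \<sigma>" and z: "interval_sums_le \<sigma> 1 n z" and z0: "z 0 = 0"
  shows "interval_sums_le \<sigma> 0 n z"
  unfolding interval_sums_le_def
proof (intro allI impI)
  fix p q assume pq: "0 \<le> p \<and> p \<le> q \<and> q \<le> n"
  consider "1 \<le> p" | "p = 0" "q = 0" | "p = 0" "0 < q" by linarith
  thus "\<bar>\<Sum>i = p..<q. z i\<bar> \<le> \<sigma> * sqrt (real (q - p))"
  proof cases
    case 1
    thus ?thesis using pq by (intro interval_sums_leD[OF z]) auto
  next
    case 3
    hence "\<bar>\<Sum>i = p..<q. z i\<bar> = \<bar>\<Sum>i = 1..<q. z i\<bar>" using z0 by (simp add: sum.atLeast_Suc_lessThan)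
    also have "\<dots> \<le> \<sigma> * sqrt (real (q - 1))" using 3 pq by (intro interval_sums_leD[OF z]) auto
    also have "\<dots> \<le> \<sigma> * sqrt (real (q - p))" using 3 \<sigma> by (intro mult_left_mono) auto
    finally show ?thesis .
  qed simp
qed

lemma interval_sums_le_cong:
  assumes "\<And>i. m \<le> i \<Longrightarrow> i < n \<Longrightarrow> z i = z' i"
  shows "interval_sums_le \<sigma> m n z = interval_sums_le \<sigma> m n z'"
proof -
  have "(\<Sum>i = p..<q. z i) = (\<Sum>i = p..<q. z' i)" if "m \<le> p" "q \<le> n" for p q
    using assms that by (intro sum.cong) auto
  thus ?thesis unfolding interval_sums_le_def by auto
qed

lemma taylor_le_of_square:
  fixes b t :: real
  assumes "b \<ge> 0" "b\<^sup>2 = 1 + t"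
  shows "1 + t / 2 - t\<^sup>2 / 2 \<le> b"
proof -
  have t: "t = b\<^sup>2 - 1" using assms by simp
  have "b - (1 + t / 2 - t\<^sup>2 / 2) = (b - 1)\<^sup>2 / 2 * (b\<^sup>2 + 2 * b)"
    unfolding t by (simp add: power2_eq_square field_simps)
  also have "\<dots> \<ge> 0" using assms(1) by simp
  finally show ?thesis by simp
qed

lemma sum_squares_ge_cube: "real n ^ 3 / 3 \<le> (\<Sum>k\<le>n. (real k)\<^sup>2)"
proof (induction n)
  case (Suc n)
  have "real (Suc n) ^ 3 / 3 \<le> real n ^ 3 / 3 + (real (Suc n))\<^sup>2"
    by (simp add: power2_eq_square power3_eq_cube algebra_simps)
  with Suc show ?case by simp
qed simp

text \<open>The trial vector is a tent of half-width \<open>n\<close> on the last \<open>2 n\<close> indices, where \<open>(B i)\<^sup>2\<close> is close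
  to \<open>1\<close>. Its squared norm is of order \<open>n ^ 3\<close>. The loss consists of the discrete Dirichlet energy
  \<open>2 n\<close>, the decrease of \<open>i / N\<close> along the window, the second-order term of the square root, and two
  noise sums, which summation by parts bounds by \<open>4 n\<^sup>2 \<sigma> \<surd>(2 n)\<close> each.\<close>

lemma largest_eigenvalue_ge_tent:
  fixes n N :: nat and A B f :: "nat \<Rightarrow> real" and \<sigma> :: real
  assumes n: "n > 0" and nN: "2 * n \<le> N" and \<sigma>: "\<sigma> \<ge> 0"
    and B: "\<And>i. i < N \<Longrightarrow> 0 \<le> B i"
    and f: "\<And>i. i < N \<Longrightarrow> (B i)\<^sup>2 = real i / real N + f i"
    and A_sums: "interval_sums_le \<sigma> 1 (N + 1) A"
    and f_sums: "interval_sums_le \<sigma> 0 N f"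
  shows "2 - 2 * n / N - (\<sigma> + 2 * n / N)\<^sup>2 - 6 / n\<^sup>2 - 24 * \<sigma> * sqrt (2 * n) / n
     \<le> largest_eigenvalue (sym_tridiag_mat N A B)" (is "_ \<le> ?lam")
proof -
  \<comment> \<open>the tent vanishes at both ends \<open>lo\<close> and \<open>N + 1\<close> of the window\<close>
  define lo where "lo = N + 1 - 2 * n"
  define W :: "nat \<Rightarrow> real" where "W i = max 0 (real n - \<bar>real i - real (N + 1 - n)\<bar>)" for i
  define e where "e = 2 * n / N + (\<sigma> + 2 * n / N)\<^sup>2"
  have N: "N > 0" using n nN by simp
  have lo: "1 \<le> lo" "lo \<le> N" "N + 1 - lo = 2 * n" using n nN by (auto simp: lo_def)
  have W_nn: "0 \<le> W i" and W_le: "W i \<le> n" for i unfolding W_def by auto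
  have W_lo: "W i = 0" if "i \<le> lo" for i
    using that n nN unfolding W_def lo_def by (auto simp: max_def of_nat_diff)
  have W_hi: "W i = 0" if "N < i" for i
    using that n nN unfolding W_def by (auto simp: max_def of_nat_diff)
  have W_lip: "\<bar>W (i + 1) - W i\<bar> \<le> 1" for i
    unfolding W_def by (auto simp: max_def abs_if)
  define J where "J = {lo..<N + 1}"
  define q where "q = (\<Sum>i\<in>J. (W i)\<^sup>2)"
  define r where "r = (\<Sum>i\<in>J. W i * W (i + 1))"
  have restrict: "(\<Sum>i = 1..N. g i) = (\<Sum>i\<in>J. g i)"
    if "\<And>i. i < lo \<Longrightarrow> g i = 0" for g :: "nat \<Rightarrow> real"
    unfolding J_def using lo that
    by (intro sum.mono_neutral_right) (auto simp: not_le)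
  have shift_q: "(\<Sum>i\<in>J. (W (i + 1))\<^sup>2) = q"
  proof -
    have "(\<Sum>i\<in>J. (W (i + 1))\<^sup>2) - q = (\<Sum>i = lo..<N + 1. (W (Suc i))\<^sup>2 - (W i)\<^sup>2)"
      unfolding q_def J_def by (simp add: sum_subtractf)
    also have "\<dots> = (W (N + 1))\<^sup>2 - (W lo)\<^sup>2" using lo by (intro sum_Suc_diff') simp
    also have "\<dots> = 0" using W_lo W_hi by simp
    finally show ?thesis by simp
  qed
  have dirichlet: "2 * q - 2 * r = (\<Sum>i\<in>J. (W (i + 1) - W i)\<^sup>2)"
  proof -
    have "(\<Sum>i\<in>J. (W (i + 1) - W i)\<^sup>2)
       = (\<Sum>i\<in>J. (W (i + 1))\<^sup>2) + (\<Sum>i\<in>J. (W i)\<^sup>2) - 2 * (\<Sum>i\<in>J. W i * W (i + 1))"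
      by (simp add: power2_diff sum.distrib sum_subtractf sum_distrib_left mult_ac)
    thus ?thesis unfolding shift_q unfolding q_def[symmetric] r_def[symmetric] by simp
  qed
  have r_le: "r \<le> q"
  proof -
    have "0 \<le> (\<Sum>i\<in>J. (W (i + 1) - W i)\<^sup>2)" by (intro sum_nonneg) simp
    thus ?thesis using dirichlet by simp
  qed
  have r_ge: "2 * q - 2 * n \<le> 2 * r"
  proof -
    have "(\<Sum>i\<in>J. (W (i + 1) - W i)\<^sup>2) \<le> (\<Sum>i\<in>J. 1)"
      using W_lip by (intro sum_mono) (simp add: abs_square_le_1)
    also have "\<dots> = 2 * n" unfolding J_def using lo(3) by simp
    finally show ?thesis using dirichlet by simp
  qed
  have q_ge: "real n ^ 3 / 3 \<le> q"
  proof -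
    have "(\<Sum>k\<le>n. (real k)\<^sup>2) = (\<Sum>i = lo..lo + n. (W i)\<^sup>2)"
    proof (rule sum.reindex_bij_witness[of _ "\<lambda>i. i - lo" "\<lambda>k. k + lo"])
      fix k assume "k \<in> {..n}"
      thus "(W (k + lo))\<^sup>2 = (real k)\<^sup>2"
        using n nN unfolding W_def lo_def by (simp add: of_nat_diff)
    qed auto
    also have "\<dots> \<le> q" unfolding q_def J_def using n nN
      by (intro sum_mono2) (auto simp: lo_def)
    finally show ?thesis using sum_squares_ge_cube[of n] by linarith
  qed
  have noise_A: "\<bar>\<Sum>i\<in>J. A i * (W i)\<^sup>2\<bar> \<le> real (2 * n) * (2 * n) * (\<sigma> * sqrt (2 * n))"
  proof -
    have "\<bar>\<Sum>i = lo..<N + 1. A i * (W i)\<^sup>2\<bar> \<le> real (N + 1 - lo) * (2 * n) * (\<sigma> * sqrt (2 * n))"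
    proof (rule abs_sum_mult_le_by_parts)
      fix r assume "r \<in> {lo..N + 1}"
      hence "\<bar>\<Sum>i = lo..<r. A i\<bar> \<le> \<sigma> * sqrt (real (r - lo))"
        using lo by (intro interval_sums_leD[OF A_sums]) auto
      also have "\<dots> \<le> \<sigma> * sqrt (2 * n)"
        using \<open>r \<in> _\<close> lo \<sigma> by (intro mult_left_mono) auto
      finally show "\<bar>\<Sum>i = lo..<r. A i\<bar> \<le> \<sigma> * sqrt (2 * n)" .
    next
      fix i assume "i \<in> {lo..<N + 1}"
      have "\<bar>(W (i + 1))\<^sup>2 - (W i)\<^sup>2\<bar> = \<bar>W (i + 1) - W i\<bar> * (W (i + 1) + W i)"
        using W_nn[of i] W_nn[of "i + 1"]
        by (simp add: power2_eq_square square_diff_square_factored abs_mult mult.commute)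
      also have "\<dots> \<le> 1 * (real n + real n)"
        using W_lip W_le W_nn by (intro mult_mono add_mono) (auto intro: add_nonneg_nonneg)
      finally show "\<bar>(W (i + 1))\<^sup>2 - (W i)\<^sup>2\<bar> \<le> 2 * n" by simp
    qed (use lo W_hi in auto)
    thus ?thesis unfolding J_def lo(3) by simp
  qed
  have noise_f: "\<bar>\<Sum>i = lo..<N. f i * (W i * W (i + 1))\<bar> \<le> real (2 * n) * (2 * n) * (\<sigma> * sqrt (2 * n))"
  proof -
    have "\<bar>\<Sum>i = lo..<N. f i * (W i * W (i + 1))\<bar> \<le> real (N - lo) * (2 * n) * (\<sigma> * sqrt (2 * n))"
    proof (rule abs_sum_mult_le_by_parts)
      fix r assume "r \<in> {lo..N}"
      hence "\<bar>\<Sum>i = lo..<r. f i\<bar> \<le> \<sigma> * sqrt (real (r - lo))"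
        using lo by (intro interval_sums_leD[OF f_sums]) auto
      also have "\<dots> \<le> \<sigma> * sqrt (2 * n)"
        using \<open>r \<in> _\<close> lo \<sigma> by (intro mult_left_mono) auto
      finally show "\<bar>\<Sum>i = lo..<r. f i\<bar> \<le> \<sigma> * sqrt (2 * n)" .
    next
      fix i assume "i \<in> {lo..<N}"
      have "\<bar>W (i + 1) * W (i + 1 + 1) - W i * W (i + 1)\<bar>
          = W (i + 1) * \<bar>(W (i + 1 + 1) - W (i + 1)) + (W (i + 1) - W i)\<bar>"
        using W_nn[of "i + 1"] by (subst abs_of_nonneg[of "W (i + 1)", symmetric], simp,
            subst abs_mult[symmetric], simp add: algebra_simps)
      also have "\<dots> \<le> real n * 2"
        using W_lip[of i] W_lip[of "i + 1"] W_le W_nn by (intro mult_mono) auto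
      finally show "\<bar>W (i + 1) * W (i + 1 + 1) - W i * W (i + 1)\<bar> \<le> 2 * n" by simp
    qed (use lo W_hi in auto)
    also have "\<dots> \<le> real (2 * n) * (2 * n) * (\<sigma> * sqrt (2 * n))"
      using lo \<sigma> by (intro mult_right_mono) auto
    finally show ?thesis .
  qed
  have offdiag: "(2 - e) * (W i * W (i + 1)) + (if i < N then f i * (W i * W (i + 1)) else 0)
      \<le> 2 * (B i * (W i * W (i + 1)))" if i: "i \<in> J" for i
  proof (cases "i < N")
    case False
    thus ?thesis using W_hi[of "i + 1"] by simp
  next
    case True
    define k where "k = real N - real i"
    define t where "t = f i - k / N"
    have k: "0 \<le> k" "k \<le> 2 * n" using i True lo unfolding k_def J_def by auto
    have sq: "(B i)\<^sup>2 = 1 + t" using f[OF True] N unfolding t_def k_def by (simp add: field_simps)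
    have "\<bar>f i\<bar> \<le> \<sigma>" using interval_sums_leD[OF f_sums, of i "i + 1"] True by simp
    moreover have kN: "k / N \<le> 2 * n / N" "0 \<le> k / N" using k N by (auto intro: divide_right_mono)
    ultimately have "\<bar>t\<bar> \<le> \<bar>\<sigma> + 2 * n / N\<bar>" unfolding t_def using \<sigma> by linarith
    hence "t\<^sup>2 \<le> (\<sigma> + 2 * n / N)\<^sup>2" by (simp only: abs_le_square_iff)
    hence "1 + (f i - k / N) / 2 - (\<sigma> + 2 * n / N)\<^sup>2 / 2 \<le> B i"
      using taylor_le_of_square[OF B[OF True] sq] unfolding t_def by linarith
    moreover have "2 - (w + z) + x \<le> 2 * b" if "1 + (x - u) / 2 - z / 2 \<le> b" "u \<le> w"
      for b u w x z :: real using that by argo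
    ultimately have "2 - e + f i \<le> 2 * B i" using kN(1) unfolding e_def by blast
    hence "(2 - e + f i) * (W i * W (i + 1)) \<le> (2 * B i) * (W i * W (i + 1))"
      using W_nn by (intro mult_right_mono) auto
    thus ?thesis using True by (simp add: algebra_simps)
  qed
  have "(\<Sum>i = 1..N. W i * jacobi A B W i)
      = (\<Sum>i\<in>J. A i * (W i)\<^sup>2) + 2 * (\<Sum>i\<in>J. B i * (W i * W (i + 1)))"
  proof -
    define h where "h i = B i * (W i * W (i + 1))" for i
    have "(\<Sum>i = 1..N. W i * jacobi A B W i) = (\<Sum>i = 1..N. A i * (W i)\<^sup>2 + h (i - 1) + h i)"
      unfolding jacobi_def h_def
      by (intro sum.cong) (auto simp: power2_eq_square algebra_simps)
    also have "\<dots> = (\<Sum>i = 1..N. A i * (W i)\<^sup>2) + (\<Sum>i = 1..N. h (i - 1)) + (\<Sum>i = 1..N. h i)"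
      by (simp add: sum.distrib)
    also have "(\<Sum>i = 1..N. h (i - 1)) = (\<Sum>i = 1..N. h i)"
    proof -
      have "(\<Sum>i = 1..N. h i) - (\<Sum>i = 1..N. h (i - 1)) = (\<Sum>i = 0..<N. h (Suc i) - h i)"
        unfolding sum_subtractf[symmetric]
        by (rule sum.reindex_bij_witness[of _ "\<lambda>i. i + 1" "\<lambda>i. i - 1"]) auto
      also have "\<dots> = h N - h 0" by (intro sum_Suc_diff') simp
      also have "\<dots> = 0" unfolding h_def using W_hi[of "N + 1"] W_lo[of 0] lo by simp
      finally show ?thesis by simp
    qed
    also have "(\<Sum>i = 1..N. h i) = (\<Sum>i\<in>J. h i)"
      by (rule restrict) (simp add: h_def W_lo)
    also have "(\<Sum>i = 1..N. A i * (W i)\<^sup>2) = (\<Sum>i\<in>J. A i * (W i)\<^sup>2)"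
      by (rule restrict) (simp add: W_lo)
    finally show ?thesis unfolding h_def by simp
  qed
  moreover have "(\<Sum>i = 1..N. (W i)\<^sup>2) = q"
    unfolding q_def by (rule restrict) (simp add: W_lo)
  ultimately have "(\<Sum>i\<in>J. A i * (W i)\<^sup>2) + 2 * (\<Sum>i\<in>J. B i * (W i * W (i + 1))) \<le> ?lam * q"
    using rayleigh_sym_tridiag_mat[OF N, of W A B] W_lo W_hi by simp
  moreover have "(2 - e) * r + (\<Sum>i = lo..<N. f i * (W i * W (i + 1)))
      \<le> 2 * (\<Sum>i\<in>J. B i * (W i * W (i + 1)))"
  proof -
    have "(\<Sum>i\<in>J. if i < N then f i * (W i * W (i + 1)) else 0)
        = (\<Sum>i = lo..<N. f i * (W i * W (i + 1)))"
      unfolding J_def by (intro sum.mono_neutral_cong_right) auto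
    hence "(2 - e) * r + (\<Sum>i = lo..<N. f i * (W i * W (i + 1)))
      = (\<Sum>i\<in>J. (2 - e) * (W i * W (i + 1)) + (if i < N then f i * (W i * W (i + 1)) else 0))"
      unfolding r_def by (simp add: sum.distrib sum_distrib_left)
    also have "\<dots> \<le> (\<Sum>i\<in>J. 2 * (B i * (W i * W (i + 1))))"
      by (intro sum_mono offdiag)
    finally show ?thesis by (simp add: sum_distrib_left)
  qed
  moreover have "e * r \<le> e * q"
    using r_le \<sigma> unfolding e_def by (intro mult_left_mono) auto
  ultimately have main: "2 * q - 2 * n - e * q - 8 * n\<^sup>2 * (\<sigma> * sqrt (2 * n)) \<le> ?lam * q"
    using r_ge noise_A noise_f by (simp add: power2_eq_square algebra_simps)
  have n3: "real n ^ 3 > 0" using n by simp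
  hence q: "q > 0" using q_ge by linarith
  have "(6 / n\<^sup>2 + 24 * \<sigma> * sqrt (2 * n) / n) * (real n ^ 3 / 3)
     = 2 * n + 8 * n\<^sup>2 * (\<sigma> * sqrt (2 * n))"
    using n by (simp add: field_simps power2_eq_square power3_eq_cube)
  moreover have "(6 / n\<^sup>2 + 24 * \<sigma> * sqrt (2 * n) / n) * (real n ^ 3 / 3)
     \<le> (6 / n\<^sup>2 + 24 * \<sigma> * sqrt (2 * n) / n) * q"
    using q_ge \<sigma> by (intro mult_left_mono) auto
  ultimately have "(2 - e - 6 / n\<^sup>2 - 24 * \<sigma> * sqrt (2 * n) / n) * q \<le> ?lam * q"
    using main by (simp add: algebra_simps)
  hence "2 - e - 6 / n\<^sup>2 - 24 * \<sigma> * sqrt (2 * n) / n \<le> ?lam" by (rule mult_right_le_imp_le) (use q in simp)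
  thus ?thesis unfolding e_def by simp
qed

section \<open>The gap for well-behaved noise\<close>

text \<open>The increment of the forward moving average of \<open>S\<close>, taken relative to \<open>S i\<close>, is minus the
  increment of \<open>S\<close>, up to the drift \<open>(S (i + 1 + n) - S (i + 1)) / n\<close>. So this sequence cancels noise
  of partial sums \<open>S\<close> while remaining bounded.\<close>

lemma moving_average_succ:
  fixes S :: "nat \<Rightarrow> real"
  assumes "n > 0"
  defines "x \<equiv> \<lambda>i. (\<Sum>j = 1..n. S (i + j) - S i) / n"
  shows "x (i + 1) = x i + (S (i + 1 + n) - S (i + 1)) / n - (S (i + 1) - S i)"
proof -
  have "(\<Sum>j = 1..n. S (i + 1 + j)) + S (i + 1) = (\<Sum>j = 1..n. S (i + j)) + S (i + 1 + n)"
    by (induction n) auto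
  hence e: "(\<Sum>j = 1..n. S (i + 1 + j)) = (\<Sum>j = 1..n. S (i + j)) + S (i + 1 + n) - S (i + 1)"
    by simp
  have "(T + u - v - real n * v) / n = (T - real n * w) / n + (u - v) / n - (v - w)" for T u v w
    using assms(1) by (simp add: field_simps)
  moreover have "(\<Sum>j = 1..n. c) = real n * c" for c :: real by simp
  ultimately show ?thesis unfolding x_def sum_subtractf e by (simp only:)
qed

lemma abs_moving_average_le:
  fixes S :: "nat \<Rightarrow> real"
  assumes "n > 0" "\<And>j. j \<in> {1..n} \<Longrightarrow> \<bar>S (i + j) - S i\<bar> \<le> R"
  shows "\<bar>(\<Sum>j = 1..n. S (i + j) - S i) / n\<bar> \<le> R"
proof -
  have "\<bar>\<Sum>j = 1..n. S (i + j) - S i\<bar> \<le> (\<Sum>j = 1..n. R)"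
    using assms(2) by (intro order_trans[OF sum_abs] sum_mono) auto
  thus ?thesis using assms(1) by (simp add: divide_le_eq mult.commute)
qed

text \<open>One step of the Riccati inequality for \<open>\<rho> = 1 + X\<close>, when the new value of \<open>X\<close> has absorbed the
  noise \<open>a + f\<close>. After multiplication by \<open>1 + X\<close> only the second-order terms, the drift \<open>d\<close> and the
  loss \<open>c\<close> are left, to be paid for by \<open>y\<close>; in the application \<open>1 - y\<close> is the mean \<open>i / N\<close> of
  \<open>(B i)\<^sup>2\<close>.\<close>

lemma riccati_step:
  fixes X :: real
  assumes X: "0 \<le> X" "X \<le> 1" and d: "\<bar>d\<bar> \<le> \<delta>" and lam: "2 - c \<le> lam" and c: "0 \<le> c"
    and y: "X\<^sup>2 + \<bar>f\<bar> * X + 2 * (\<delta> + c) \<le> y"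
  shows "1 + (X + d - (a + f)) + (1 - y + f) / (1 + X) \<le> lam - a"
proof -
  have "f * X \<ge> - (\<bar>f\<bar> * X)" using X by (simp add: abs_if)
  moreover have "(d + c) * (1 + X) \<le> (\<delta> + c) * 2"
    using X d c by (intro mult_mono) auto
  ultimately have "1 - y + f \<le> (1 - X + f - d - c) * (1 + X)"
    using y by (simp add: algebra_simps power2_eq_square)
  hence "(1 - y + f) / (1 + X) \<le> 1 - X + f - d - c" using X by (simp add: divide_le_eq)
  thus ?thesis using lam by simp
qed

lemma power_one_plus_ge_exp:
  fixes g :: real
  assumes "0 \<le> g" "g \<le> 1"
  shows "exp (k * g / 2) \<le> (1 + g) ^ k"
proof -
  have "exp (g / 2) \<le> 1 + g / 2 + (g / 2)\<^sup>2" using assms by (intro exp_bound) auto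
  also have "\<dots> \<le> 1 + g"
  proof -
    have "g * g \<le> g * 1" using assms by (intro mult_left_mono) auto
    thus ?thesis using assms by (simp add: power2_eq_square)
  qed
  finally have "exp (g / 2) ^ k \<le> (1 + g) ^ k" by (intro power_mono) auto
  thus ?thesis by (simp add: exp_of_nat_mult[symmetric])
qed

text \<open>Here \<open>L\<close> and \<open>s\<close> stand for \<open>ln N\<close> and \<open>N powr (1 / 3)\<close>, and the numerical conditions hold
  for large \<open>N\<close>. The weights \<open>1 + x i\<close> have \<open>10 L / s \<le> x i \<le> 30 L / s\<close>, so the second-order
  terms are of order \<open>L\<^sup>2 / s\<^sup>2\<close>. At distance at least \<open>h = s * L ^ 3\<close> from the end the
  deficit \<open>1 - i / N\<close> is at least \<open>h / N = L ^ 3 / s\<^sup>2\<close>, which is larger. The remaining \<open>h\<close> or more indices of the minor serve for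
  the growth of the eigenvector, by a factor \<open>1 + L / s\<close> each.\<close>

lemma trailing_gap_of_good_noise:
  fixes N l :: nat and A B f :: "nat \<Rightarrow> real" and s L :: real
  assumes s3: "s ^ 3 = real N" and s: "30 * L \<le> s" and L: "992 * L\<^sup>2 + 12 * L \<le> L ^ 3" "1 \<le> L"
    and large: "10 / s\<^sup>2 + 18 * L\<^sup>2 / s ^ 3 + 32 / s ^ 4 + 102 * L / s\<^sup>2 \<le> L\<^sup>2 / s\<^sup>2"
    and l: "2 * s * L ^ 3 < real l" "l \<le> N"
    and B: "B 0 = 0" "\<And>i. i \<in> {1..<N} \<Longrightarrow> 0 < B i"
    and f: "\<And>i. i < N \<Longrightarrow> (B i)\<^sup>2 = real i / real N + f i"
    and \<sigma>: "\<sigma> = 3 * L / sqrt (real N)"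
    and A_sums: "interval_sums_le \<sigma> 1 (N + 1) A"
    and f_sums: "interval_sums_le \<sigma> 0 N f"
  shows "\<bar>largest_eigenvalue (sym_tridiag_mat N A B)
      - largest_eigenvalue (sym_tridiag_mat l (\<lambda>i. A (i + (N - l))) (\<lambda>i. B (i + (N - l))))\<bar>
      \<le> 2 * exp (- (L ^ 4) / 2)"
proof -
  define n where "n = nat \<lceil>s\<rceil>"
  define h where "h = s * L ^ 3"
  define m where "m = nat \<lceil>h\<rceil>"
  define I where "I = N - m"
  define d where "d = N - l"
  define lam where "lam = largest_eigenvalue (sym_tridiag_mat N A B)"
  have s30: "30 \<le> s" using s L by linarith
  have "1 \<le> L ^ 3" using L(2) by (rule one_le_power)
  hence "s * 1 \<le> h" unfolding h_def using s30 by (intro mult_left_mono) auto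
  hence h: "s \<le> h" "1 \<le> h" using s30 by auto
  have n: "s \<le> real n" "real n \<le> 2 * s" "n > 0" using s30 unfolding n_def by linarith+
  have m: "h \<le> real m" "real m < h + 1" "n \<le> m" "m > 0"
    using h unfolding m_def n_def by (auto intro!: nat_mono ceiling_mono) linarith+
  have l2: "2 * h < real l" using l(1) by (simp add: h_def)
  have ml: "m \<le> l" using m l2 h by linarith
  have I: "d \<le> I" "I < N" "I + n \<le> N" "real I \<le> real N - h"
    using ml m l(2) unfolding d_def I_def by auto
  have Nd: "N = d + l" unfolding d_def using l(2) by simp
  have N: "real N > 0" unfolding s3[symmetric] using s30 by simp
  have \<sigma>_nn: "\<sigma> \<ge> 0" unfolding \<sigma> using L by simp
  have \<sigma>2: "\<sigma>\<^sup>2 = 9 * L\<^sup>2 / s ^ 3"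
    unfolding \<sigma> s3 using N by (simp add: power_divide power_mult_distrib)
  have \<sigma>_le: "\<sigma> \<le> 3 * L / s"
  proof (rule power2_le_imp_le)
    have "\<sigma>\<^sup>2 \<le> 9 * L\<^sup>2 / s\<^sup>2"
      unfolding \<sigma>2 using s30 by (intro divide_left_mono power_increasing) auto
    thus "\<sigma>\<^sup>2 \<le> (3 * L / s)\<^sup>2" by (simp add: power_divide power_mult_distrib)
  qed (use L s30 in auto)
  have Ls: "0 \<le> L / s" "30 * (L / s) \<le> 1" using L s s30 by (auto simp: divide_simps)
  have lam: "2 - L\<^sup>2 / s\<^sup>2 \<le> lam"
  proof -
    have "2 * n \<le> N"
    proof -
      have "2 * 2 \<le> s * s" using s30 by (intro mult_mono) auto
      hence "4 * s \<le> s * s * s" using s30 by (intro mult_right_mono) auto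
      hence "2 * real n \<le> N" using n s3[unfolded power3_eq_cube] by linarith
      thus ?thesis by linarith
    qed
    have B_nn: "0 \<le> B i" if "i < N" for i
      using B that by (cases "i = 0") (auto intro: less_imp_le)
    have tent: "2 - 2 * n / N - (\<sigma> + 2 * n / N)\<^sup>2 - 6 / n\<^sup>2 - 24 * \<sigma> * sqrt (2 * n) / n \<le> lam"
      unfolding lam_def
      by (rule largest_eigenvalue_ge_tent[OF n(3) \<open>2 * n \<le> N\<close> \<sigma>_nn B_nn f A_sums f_sums])
    have 1: "2 * n / N \<le> 4 / s\<^sup>2"
    proof -
      have "2 * n / N \<le> 4 * s / s ^ 3" unfolding s3 using n N by (intro divide_right_mono) auto
      thus ?thesis using s30 by (simp add: power2_eq_square power3_eq_cube)
    qed
    have 2: "(\<sigma> + 2 * n / N)\<^sup>2 \<le> 18 * L\<^sup>2 / s ^ 3 + 32 / s ^ 4"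
    proof -
      have "(\<sigma> + 2 * n / N)\<^sup>2 \<le> (\<sigma> + 4 / s\<^sup>2)\<^sup>2"
        using 1 \<sigma>_nn N by (intro power_mono add_left_mono add_nonneg_nonneg) auto
      also have "\<dots> \<le> 2 * \<sigma>\<^sup>2 + 2 * (4 / s\<^sup>2)\<^sup>2"
        using sum_squares_bound[of \<sigma> "4 / s\<^sup>2"] by (simp add: power2_sum)
      also have "\<dots> = 18 * L\<^sup>2 / s ^ 3 + 32 / s ^ 4" unfolding \<sigma>2 by (simp add: power_divide)
      finally show ?thesis .
    qed
    have 3: "6 / (n\<^sup>2) \<le> 6 / s\<^sup>2"
      unfolding of_nat_power using n s30 by (intro divide_left_mono power_mono) auto
    have 4: "24 * \<sigma> * sqrt (2 * n) / n \<le> 102 * L / s\<^sup>2"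
    proof (rule power2_le_imp_le)
      have "(24 * \<sigma> * sqrt (2 * n) / n)\<^sup>2 = 10368 * L\<^sup>2 / (s ^ 3 * n)"
        using n by (simp add: power_mult_distrib power_divide \<sigma>2) (simp add: power2_eq_square)
      also have "\<dots> \<le> 10404 * L\<^sup>2 / (s ^ 3 * s)"
        using n s30 by (intro frac_le mult_mono) auto
      also have "\<dots> = (102 * L / s\<^sup>2)\<^sup>2"
        by (simp add: power_mult_distrib power_divide eval_nat_numeral mult_ac)
      finally show "(24 * \<sigma> * sqrt (2 * n) / n)\<^sup>2 \<le> (102 * L / s\<^sup>2)\<^sup>2" .
    qed (use L s30 in auto)
    have 5: "10 / s\<^sup>2 = 4 / s\<^sup>2 + 6 / s\<^sup>2" by (simp add: add_divide_distrib[symmetric])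
    have "2 - e \<le> y"
      if "2 - t1 - t2 - t3 - t4 \<le> y" "t1 \<le> u1" "t2 \<le> u2 + u2'" "t3 \<le> u3" "t4 \<le> u4"
        "u = u1 + u3" "u + u2 + u2' + u4 \<le> e" for e y t1 t2 t3 t4 u u1 u2 u2' u3 u4 :: real
      using that by argo
    from this[OF tent 1 2 3 4 5 large] show ?thesis .
  qed
  \<comment> \<open>the noise entering step \<open>k\<close> of the recursion is \<open>A k + f (k - 1)\<close>\<close>
  define S where "S r = (\<Sum>k = 1..<r + 1. A k + f (k - 1))" for r
  have S_diff: "\<bar>S (i + j) - S i\<bar> \<le> 2 * \<sigma> * sqrt (real j)" if "i + j \<le> N" for i j
  proof -
    have "S (i + j) = S i + (\<Sum>k = i + 1..<i + j + 1. A k + f (k - 1))"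
      unfolding S_def by (rule sum.atLeastLessThan_concat[symmetric]) auto
    hence "S (i + j) - S i = (\<Sum>k = i + 1..<i + j + 1. A k) + (\<Sum>k = i + 1..<i + j + 1. f (k - 1))"
      by (simp add: sum.distrib)
    also have "(\<Sum>k = i + 1..<i + j + 1. f (k - 1)) = (\<Sum>k = i..<i + j. f k)"
      by (rule sum.reindex_bij_witness[of _ "\<lambda>k. k + 1" "\<lambda>k. k - 1"]) auto
    finally show ?thesis
      using interval_sums_leD[OF A_sums, of "i + 1" "i + j + 1"]
        interval_sums_leD[OF f_sums, of i "i + j"] that by simp
  qed
  \<comment> \<open>the constant is twice the bound \<open>10 L / s\<close> of the moving average, which keeps \<open>x\<close> positive\<close>
  define x where "x i = 20 * L / s + (\<Sum>j = 1..n. S (i + j) - S i) / n" for i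
  have x_succ: "x (i + 1) = x i + (S (i + 1 + n) - S (i + 1)) / n - (A (i + 1) + f i)" for i
    using moving_average_succ[OF n(3), of S i] unfolding x_def by (simp add: S_def)
  have x_bounds: "10 * L / s \<le> x i \<and> x i \<le> 30 * L / s" if i: "i \<le> I" for i
  proof -
    have "2 * \<sigma> * sqrt n \<le> 10 * L / s"
    proof (rule power2_le_imp_le)
      have "(2 * \<sigma> * sqrt n)\<^sup>2 = 36 * L\<^sup>2 * n / s ^ 3"
        by (simp add: power_mult_distrib \<sigma>2)
      also have "\<dots> \<le> 36 * L\<^sup>2 * (2 * s) / s ^ 3"
        using n s30 by (intro divide_right_mono mult_left_mono) auto
      also have "\<dots> = 72 * L\<^sup>2 / s\<^sup>2" using s30 by (simp add: power2_eq_square power3_eq_cube)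
      also have "\<dots> \<le> 100 * L\<^sup>2 / s\<^sup>2" by (intro divide_right_mono) auto
      also have "\<dots> = (10 * L / s)\<^sup>2" by (simp add: power_divide power_mult_distrib)
      finally show "(2 * \<sigma> * sqrt n)\<^sup>2 \<le> (10 * L / s)\<^sup>2" .
    qed (use L s30 in auto)
    moreover have "\<bar>(\<Sum>j = 1..n. S (i + j) - S i) / n\<bar> \<le> 2 * \<sigma> * sqrt n"
    proof (rule abs_moving_average_le[OF n(3)])
      fix j assume j: "j \<in> {1..n}"
      hence "\<bar>S (i + j) - S i\<bar> \<le> 2 * \<sigma> * sqrt j" using I i by (intro S_diff) auto
      also have "\<dots> \<le> 2 * \<sigma> * sqrt n" using j \<sigma>_nn by (intro mult_left_mono) auto
      finally show "\<bar>S (i + j) - S i\<bar> \<le> 2 * \<sigma> * sqrt n" .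
    qed
    ultimately show ?thesis unfolding x_def times_divide_eq_right[symmetric] by linarith
  qed
  have f_le: "\<bar>f i\<bar> \<le> \<sigma>" if "i < N" for i
    using interval_sums_leD[OF f_sums, of i "i + 1"] that by simp
  have riccati: "(1 + x (k + 1)) + (B k)\<^sup>2 / (1 + x k) \<le> lam - A (k + 1)" if k: "k + 1 \<le> I" for k
  proof -
    have kN: "k < N" using k I by simp
    have X: "0 \<le> x k" "x k \<le> 1" "x k \<le> 30 * (L / s)" using x_bounds[of k] k Ls by auto
    have drift: "\<bar>(S (k + 1 + n) - S (k + 1)) / n\<bar> \<le> 6 * L / s\<^sup>2"
    proof -
      have "\<bar>(S (k + 1 + n) - S (k + 1)) / n\<bar> \<le> 2 * \<sigma> * sqrt n / n"
        using S_diff[of "k + 1" n] k I n by (simp add: divide_right_mono)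
      also have "\<dots> \<le> 6 * L / s\<^sup>2"
      proof (rule power2_le_imp_le)
        have "(2 * \<sigma> * sqrt n / n)\<^sup>2 = 36 * L\<^sup>2 / (s ^ 3 * n)"
          using n by (simp add: power_mult_distrib power_divide \<sigma>2) (simp add: power2_eq_square)
        also have "\<dots> \<le> 36 * L\<^sup>2 / (s ^ 3 * s)"
          using n s30 by (intro divide_left_mono mult_left_mono) auto
        also have "\<dots> = (6 * L / s\<^sup>2)\<^sup>2"
          by (simp add: power_mult_distrib power_divide eval_nat_numeral mult_ac)
        finally show "(2 * \<sigma> * sqrt n / n)\<^sup>2 \<le> (6 * L / s\<^sup>2)\<^sup>2" .
      qed (use L s30 in auto)
      finally show ?thesis .
    qed
    define y where "y = 1 - real k / real N"
    have "(x k)\<^sup>2 + \<bar>f k\<bar> * x k + 2 * (6 * L / s\<^sup>2 + L\<^sup>2 / s\<^sup>2) \<le> y"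
    proof -
      have xx: "(x k)\<^sup>2 \<le> (30 * (L / s))\<^sup>2" using X by (intro power_mono) auto
      have fx: "\<bar>f k\<bar> * x k \<le> (3 * (L / s)) * (30 * (L / s))"
        using f_le[OF kN] \<sigma>_le X Ls by (intro mult_mono) auto
      have "(x k)\<^sup>2 + \<bar>f k\<bar> * x k + 2 * (6 * L / s\<^sup>2 + L\<^sup>2 / s\<^sup>2)
          \<le> (992 * L\<^sup>2 + 12 * L) / s\<^sup>2"
      proof -
        have e: "(30 * (L / s))\<^sup>2 = 900 * (L / s)\<^sup>2" "3 * (L / s) * (30 * (L / s)) = 90 * (L / s)\<^sup>2"
          "L\<^sup>2 / s\<^sup>2 = (L / s)\<^sup>2" "(992 * L\<^sup>2 + 12 * L) / s\<^sup>2 = 992 * (L / s)\<^sup>2 + 2 * (6 * L / s\<^sup>2)"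
          by (auto simp: power_mult_distrib power_divide add_divide_distrib power2_eq_square)
        have "a + b + 2 * (d + c) \<le> 992 * c + 2 * d" if "a \<le> 900 * c" "b \<le> 90 * c" for a b c d :: real
          using that by argo
        from this[OF xx[unfolded e] fx[unfolded e]] show ?thesis unfolding e .
      qed
      also have "\<dots> \<le> L ^ 3 / s\<^sup>2" using L(1) by (intro divide_right_mono) auto
      also have "\<dots> = h / N" unfolding h_def s3[symmetric] using s30
        by (simp add: power2_eq_square power3_eq_cube)
      also have "\<dots> \<le> (real N - real k) / N" using I k N by (intro divide_right_mono) auto
      also have "\<dots> = y" unfolding y_def using N by (simp add: field_simps)
      finally show ?thesis .
    qed
    from riccati_step[OF X(1,2) drift lam _ this, of "A (k + 1)"]
    have "1 + (x k + (S (k + 1 + n) - S (k + 1)) / n - (A (k + 1) + f k)) + (1 - y + f k) / (1 + x k)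
        \<le> lam - A (k + 1)" by simp
    moreover have "1 - y + f k = (B k)\<^sup>2" unfolding y_def f[OF kN] by simp
    ultimately show ?thesis unfolding x_succ[of k] by (simp only:)
  qed
  have grow: "(1 + L / s) * B i \<le> 1 + x i" if i: "i \<le> I" for i
  proof -
    have iN: "i < N" using i I by simp
    have "B i \<le> 1 + \<sigma>"
    proof (rule power2_le_imp_le)
      have "real i / real N \<le> 1" using iN by simp
      hence "(B i)\<^sup>2 \<le> 1 + \<sigma>" using f[OF iN] f_le[OF iN] by linarith
      also have "\<dots> \<le> (1 + \<sigma>)\<^sup>2" using \<sigma>_nn by (simp add: power2_eq_square algebra_simps)
      finally show "(B i)\<^sup>2 \<le> (1 + \<sigma>)\<^sup>2" .
    qed (use \<sigma>_nn in simp)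
    also have "\<dots> \<le> 1 + 3 * (L / s)" using \<sigma>_le by simp
    finally have "(1 + L / s) * B i \<le> (1 + L / s) * (1 + 3 * (L / s))"
      using Ls by (intro mult_left_mono) auto
    also have "\<dots> \<le> 1 + 10 * (L / s)"
    proof -
      have "(1 + u) * (1 + 3 * u) \<le> 1 + 10 * u" if "0 \<le> u" "30 * u \<le> 1" for u :: real
      proof -
        have "u * u \<le> u * 1" using that by (intro mult_left_mono) auto
        thus ?thesis using that by (simp add: algebra_simps)
      qed
      thus ?thesis using Ls by blast
    qed
    finally show ?thesis using x_bounds[OF i] by simp
  qed
  have xpos: "0 < 1 + x i" if "i \<le> I" for i
    using x_bounds[OF that] Ls by (simp add: add_pos_nonneg)
  have "\<bar>lam - largest_eigenvalue (sym_tridiag_mat l (\<lambda>i. A (i + d)) (\<lambda>i. B (i + d)))\<bar>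
      \<le> B d / (1 + L / s) ^ (I + 1 - d)"
  proof (rule trailing_gap_le_geometric[where \<rho> = "\<lambda>i. 1 + x i"])
    show "0 < l" using ml m by simp
    show "lam = largest_eigenvalue (sym_tridiag_mat (d + l) A B)" unfolding lam_def Nd[symmetric] ..
    show "1 + x i + (B (i - 1))\<^sup>2 / (1 + x (i - 1)) \<le> lam - A i" if "i \<in> {1..I}" for i
      using riccati[of "i - 1"] that by simp
    show "d \<le> I" "I < d + l" "0 \<le> L / s" "B 0 = 0" using I Nd Ls B by auto
    show "0 < B i" if "i \<in> {1..<d + l}" for i using B(2) that Nd by simp
  qed (rule refl xpos grow, assumption?)+
  also have "\<dots> \<le> 2 / exp (L ^ 4 / 2)"
  proof (rule frac_le)
    have "0 \<le> B d" using B I by (cases "d = 0") (auto intro: less_imp_le)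
    hence "1 * B d \<le> (1 + L / s) * B d" using Ls by (intro mult_right_mono) auto
    hence "B d \<le> (1 + L / s) * B d" by simp
    also have "\<dots> \<le> 1 + x d" using grow[OF I(1)] .
    also have "\<dots> \<le> 2" using x_bounds[OF I(1)] Ls by simp
    finally show "B d \<le> 2" .
    have "I + 1 - d = l + 1 - m" using ml l(2) unfolding I_def d_def by simp
    hence "real (I + 1 - d) = real l + 1 - real m" using ml by (simp add: of_nat_diff)
    hence "h \<le> real (I + 1 - d)" using m(2) l2 h(2) by linarith
    hence "h * (L / s) / 2 \<le> real (I + 1 - d) * (L / s) / 2"
      using Ls by (intro divide_right_mono mult_right_mono) auto
    also have "h * (L / s) / 2 = L ^ 4 / 2" unfolding h_def using s30 by (simp add: eval_nat_numeral)
    finally have "exp (L ^ 4 / 2) \<le> exp (real (I + 1 - d) * (L / s) / 2)" by simp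
    also have "\<dots> \<le> (1 + L / s) ^ (I + 1 - d)" using Ls by (intro power_one_plus_ge_exp) auto
    finally show "exp (L ^ 4 / 2) \<le> (1 + L / s) ^ (I + 1 - d)" .
  qed auto
  also have "2 / exp (L ^ 4 / 2) = 2 * exp (- (L ^ 4) / 2)"
    unfolding minus_divide_left[symmetric] exp_minus by (rule divide_inverse)
  finally show ?thesis unfolding lam_def d_def .
qed

section \<open>Tail bounds for the noise\<close>

lemma (in prob_space) indep_sets_reindex:
  assumes h: "inj_on h I" and F: "indep_sets F (h ` I)"
  shows "indep_sets (\<lambda>i. F (h i)) I"
  unfolding indep_sets_def
proof (intro conjI ballI allI impI)
  show "F (h i) \<subseteq> events" if "i \<in> I" for i using F that unfolding indep_sets_def by auto
next
  fix J A assume J: "J \<subseteq> I" "J \<noteq> {}" "finite J" and A: "A \<in> Pi J (\<lambda>i. F (h i))"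
  define A' where "A' k = A (the_inv_into J h k)" for k
  have hJ: "inj_on h J" using h J(1) by (rule inj_on_subset)
  have A': "A' (h j) = A j" if "j \<in> J" for j
    unfolding A'_def using the_inv_into_f_f[OF hJ that] by simp
  have "prob (\<Inter>k\<in>h ` J. A' k) = (\<Prod>k\<in>h ` J. prob (A' k))"
  proof -
    have "h ` J \<subseteq> h ` I" "h ` J \<noteq> {}" "finite (h ` J)" "A' \<in> Pi (h ` J) F"
      using J A A' by auto
    thus ?thesis using F unfolding indep_sets_def by blast
  qed
  also have "(\<Inter>k\<in>h ` J. A' k) = (\<Inter>j\<in>J. A j)" using A' by auto
  also have "(\<Prod>k\<in>h ` J. prob (A' k)) = (\<Prod>j\<in>J. prob (A j))"
    unfolding prod.reindex[OF hJ] using A' by simp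
  finally show "prob (\<Inter>j\<in>J. A j) = (\<Prod>j\<in>J. prob (A j))" .
qed

lemma (in prob_space) indep_vars_reindex:
  assumes "inj_on h I" "indep_vars M' X (h ` I)"
  shows "indep_vars (\<lambda>i. M' (h i)) (\<lambda>i. X (h i)) I"
  using assms(2) indep_sets_reindex[OF assms(1)] unfolding indep_vars_def2 by auto

text \<open>Chernoff bound. The moment generating functions are nonnegative integrals, which makes
  integrability assumptions unnecessary.\<close>

lemma (in prob_space) prob_sum_ge_le:
  fixes X :: "'i \<Rightarrow> 'a \<Rightarrow> real" and t e R :: real
  assumes I: "finite I" and ind: "indep_vars (\<lambda>_. borel) X I" and t: "t > 0"
    and mgf: "\<And>i. i \<in> I \<Longrightarrow> (\<integral>\<^sup>+\<omega>. ennreal (exp (t * X i \<omega>)) \<partial>M) \<le> ennreal (exp e)"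
  shows "prob {\<omega> \<in> space M. R \<le> (\<Sum>i\<in>I. X i \<omega>)} \<le> exp (card I * e - t * R)"
proof -
  have rv [measurable]: "X i \<in> borel_measurable M" if "i \<in> I" for i
    using ind that unfolding indep_vars_def by auto
  have sum_rv [measurable]: "(\<lambda>\<omega>. \<Sum>i\<in>I. X i \<omega>) \<in> borel_measurable M"
    using rv by (rule borel_measurable_sum)
  have "emeasure M {\<omega> \<in> space M. R \<le> (\<Sum>i\<in>I. X i \<omega>)}
      \<le> ennreal (exp (- t * R)) *
        (\<integral>\<^sup>+\<omega>. ennreal (exp (t * (\<Sum>i\<in>I. X i \<omega>))) * indicator (space M) \<omega> \<partial>M)"
    by (rule Chernoff_ineq_nn_integral_ge[OF t]) auto
  also have "(\<integral>\<^sup>+\<omega>. ennreal (exp (t * (\<Sum>i\<in>I. X i \<omega>))) * indicator (space M) \<omega> \<partial>M)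
      = (\<integral>\<^sup>+\<omega>. (\<Prod>i\<in>I. ennreal (exp (t * X i \<omega>))) \<partial>M)"
    by (intro nn_integral_cong) (simp add: sum_distrib_left exp_sum[OF I] prod_ennreal)
  also have "\<dots> = (\<Prod>i\<in>I. \<integral>\<^sup>+\<omega>. ennreal (exp (t * X i \<omega>)) \<partial>M)"
  proof (rule indep_vars_nn_integral[OF I])
    show "indep_vars (\<lambda>_. borel) (\<lambda>i \<omega>. ennreal (exp (t * X i \<omega>))) I"
      by (rule indep_vars_compose2[OF ind]) measurable
  qed simp
  also have "\<dots> \<le> (\<Prod>i\<in>I. ennreal (exp e))"
    using mgf by (intro prod_mono_ennreal) auto
  also have "\<dots> = ennreal (exp (card I * e))"
    by (simp add: ennreal_power exp_of_nat_mult)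
  finally have "emeasure M {\<omega> \<in> space M. R \<le> (\<Sum>i\<in>I. X i \<omega>)}
      \<le> ennreal (exp (- t * R)) * ennreal (exp (card I * e))"
    by (simp add: mult_left_mono)
  also have "\<dots> = ennreal (exp (card I * e - t * R))"
    by (simp add: ennreal_mult[symmetric] exp_add[symmetric])
  finally show ?thesis by (simp add: emeasure_eq_measure)
qed

text \<open>Union bound over all intervals. For an interval of length \<open>k\<close> the Chernoff bound is used with
  \<open>t = 1 / \<surd>k\<close>, which turns the threshold \<open>L * \<surd>k\<close> into the probability \<open>exp (c - L)\<close>. Since
  \<open>t \<le> 1\<close>, the moment generating function is needed near \<open>0\<close> only, which allows for subexponential
  variables.\<close>

lemma (in prob_space) prob_not_interval_sums_le:
  fixes X :: "nat \<Rightarrow> 'a \<Rightarrow> real"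
  assumes ind: "indep_vars (\<lambda>_. borel) X {m..<n}"
    and mgf: "\<And>i t. i \<in> {m..<n} \<Longrightarrow> \<bar>t\<bar> \<le> 1 \<Longrightarrow>
        (\<integral>\<^sup>+\<omega>. ennreal (exp (t * X i \<omega>)) \<partial>M) \<le> ennreal (exp (c * t\<^sup>2))"
  obtains E where "E \<in> events" "{\<omega> \<in> space M. \<not> interval_sums_le L m n (\<lambda>i. X i \<omega>)} \<subseteq> E"
    "prob E \<le> 2 * (real n + 1)\<^sup>2 * exp (c - L)"
proof -
  define D where "D = {(p, q). m \<le> p \<and> p < q \<and> q \<le> n}"
  define E where "E = (\<lambda>(p, q). {\<omega> \<in> space M. L * sqrt (real (q - p)) \<le> (\<Sum>i = p..<q. X i \<omega>)}
     \<union> {\<omega> \<in> space M. L * sqrt (real (q - p)) \<le> (\<Sum>i = p..<q. - X i \<omega>)})"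
  have D: "D \<subseteq> {..n} \<times> {..n}" unfolding D_def by auto
  hence finD: "finite D" by (rule finite_subset) simp
  have rv: "X i \<in> borel_measurable M" if "i \<in> {m..<n}" for i
    using ind that unfolding indep_vars_def by auto
  have E: "E pq \<in> events" "prob (E pq) \<le> 2 * exp (c - L)" if pq: "pq \<in> D" for pq
  proof -
    obtain p q where pq': "pq = (p, q)" "m \<le> p" "p < q" "q \<le> n" using pq unfolding D_def by auto
    have sub: "{p..<q} \<subseteq> {m..<n}" using pq' by auto
    have [measurable]: "(\<lambda>\<omega>. \<Sum>i = p..<q. X i \<omega>) \<in> borel_measurable M"
      "(\<lambda>\<omega>. \<Sum>i = p..<q. - X i \<omega>) \<in> borel_measurable M"
      using sub rv by (auto intro!: borel_measurable_sum borel_measurable_uminus)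
    show "E pq \<in> events" unfolding E_def pq'(1) by simp
    define t where "t = 1 / sqrt (real (q - p))"
    have t: "0 < t" "t \<le> 1" "t\<^sup>2 = 1 / real (q - p)" "t * sqrt (real (q - p)) = 1"
      using pq' by (auto simp: t_def power_divide)
    have ind1: "indep_vars (\<lambda>_. borel) X {p..<q}" by (rule indep_vars_subset[OF ind sub])
    have ind2: "indep_vars (\<lambda>_. borel) (\<lambda>i \<omega>. - X i \<omega>) {p..<q}"
      by (rule indep_vars_compose2[OF ind1]) measurable
    have exponent: "real (card {p..<q}) * (c * t\<^sup>2) - t * (L * sqrt (real (q - p))) = c - L"
      using pq' t by (simp add: field_simps)
    have "prob (E pq) \<le> prob {\<omega> \<in> space M. L * sqrt (real (q - p)) \<le> (\<Sum>i = p..<q. X i \<omega>)}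
       + prob {\<omega> \<in> space M. L * sqrt (real (q - p)) \<le> (\<Sum>i = p..<q. - X i \<omega>)}"
      unfolding E_def pq'(1) split_conv by (intro measure_Un_le) auto
    also have "\<dots> \<le> exp (c - L) + exp (c - L)"
    proof (rule add_mono)
      have "(\<integral>\<^sup>+\<omega>. ennreal (exp (t * X i \<omega>)) \<partial>M) \<le> ennreal (exp (c * t\<^sup>2))"
        if "i \<in> {p..<q}" for i using mgf[of i t] t sub that by auto
      from prob_sum_ge_le[OF _ ind1 t(1) this, of "L * sqrt (real (q - p))"]
      show "prob {\<omega> \<in> space M. L * sqrt (real (q - p)) \<le> (\<Sum>i = p..<q. X i \<omega>)} \<le> exp (c - L)"
        unfolding exponent by simp
      have "(\<integral>\<^sup>+\<omega>. ennreal (exp (t * - X i \<omega>)) \<partial>M) \<le> ennreal (exp (c * t\<^sup>2))"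
        if "i \<in> {p..<q}" for i using mgf[of i "- t"] t sub that by auto
      from prob_sum_ge_le[OF _ ind2 t(1) this, of "L * sqrt (real (q - p))"]
      show "prob {\<omega> \<in> space M. L * sqrt (real (q - p)) \<le> (\<Sum>i = p..<q. - X i \<omega>)} \<le> exp (c - L)"
        unfolding exponent by simp
    qed
    finally show "prob (E pq) \<le> 2 * exp (c - L)" by simp
  qed
  show ?thesis
  proof (rule that[of "\<Union>pq\<in>D. E pq"])
    show "(\<Union>pq\<in>D. E pq) \<in> events" using E finD by (intro sets.finite_UN) auto
    show "{\<omega> \<in> space M. \<not> interval_sums_le L m n (\<lambda>i. X i \<omega>)} \<subseteq> (\<Union>pq\<in>D. E pq)"
    proof safe
      fix \<omega> assume \<omega>: "\<omega> \<in> space M" "\<not> interval_sums_le L m n (\<lambda>i. X i \<omega>)"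
      then obtain p q where pq: "m \<le> p" "p \<le> q" "q \<le> n"
        "L * sqrt (real (q - p)) < \<bar>\<Sum>i = p..<q. X i \<omega>\<bar>"
        unfolding interval_sums_le_def by (auto simp: not_le)
      hence "p \<noteq> q" by auto
      hence "(p, q) \<in> D" using pq unfolding D_def by auto
      moreover have "\<omega> \<in> E (p, q)"
        using pq(4) \<omega>(1) unfolding E_def by (auto simp: sum_negf abs_if split: if_splits)
      ultimately show "\<omega> \<in> (\<Union>pq\<in>D. E pq)" by blast
    qed
    have "prob (\<Union>pq\<in>D. E pq) \<le> (\<Sum>pq\<in>D. prob (E pq))"
      using E finD by (intro finite_measure_subadditive_finite) auto
    also have "\<dots> \<le> (\<Sum>pq\<in>D. 2 * exp (c - L))" using E by (intro sum_mono) auto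
    also have "\<dots> = real (card D) * (2 * exp (c - L))" by simp
    also have "\<dots> \<le> (real n + 1)\<^sup>2 * (2 * exp (c - L))"
    proof (rule mult_right_mono)
      have "card D \<le> card ({..n} \<times> {..n})" using D by (intro card_mono) auto
      also have "\<dots> = (n + 1)\<^sup>2" by (simp add: card_cartesian_product power2_eq_square)
      finally have "real (card D) \<le> real ((n + 1)\<^sup>2)" by (simp only: of_nat_le_iff)
      thus "real (card D) \<le> (real n + 1)\<^sup>2" by (simp add: add.commute)
    qed simp
    finally show "prob (\<Union>pq\<in>D. E pq) \<le> 2 * (real n + 1)\<^sup>2 * exp (c - L)" by (simp add: mult_ac)
  qed
qed

lemma nn_integral_exp_normal:
  assumes \<sigma>: "\<sigma> > 0"
  shows "(\<integral>\<^sup>+x. ennreal (exp (t * x)) \<partial>density lborel (normal_density 0 \<sigma>))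
    = ennreal (exp (t\<^sup>2 * \<sigma>\<^sup>2 / 2))"
proof -
  interpret N: prob_space "density lborel (normal_density (t * \<sigma>\<^sup>2) \<sigma>)"
    using \<sigma> by (rule prob_space_normal_density)
  have shift: "normal_density 0 \<sigma> x * exp (t * x)
      = exp (t\<^sup>2 * \<sigma>\<^sup>2 / 2) * normal_density (t * \<sigma>\<^sup>2) \<sigma> x" for x
  proof -
    have "- (x\<^sup>2) / (2 * \<sigma>\<^sup>2) + t * x = t\<^sup>2 * \<sigma>\<^sup>2 / 2 + - ((x - t * \<sigma>\<^sup>2)\<^sup>2) / (2 * \<sigma>\<^sup>2)"
      using \<sigma> by (simp add: field_simps power2_eq_square)
    hence "exp (- (x\<^sup>2) / (2 * \<sigma>\<^sup>2)) * exp (t * x)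
      = exp (t\<^sup>2 * \<sigma>\<^sup>2 / 2) * exp (- ((x - t * \<sigma>\<^sup>2)\<^sup>2) / (2 * \<sigma>\<^sup>2))"
      by (simp only: exp_add[symmetric])
    thus ?thesis unfolding normal_density_def by simp
  qed
  have "(\<integral>\<^sup>+x. ennreal (exp (t * x)) \<partial>density lborel (normal_density 0 \<sigma>))
     = (\<integral>\<^sup>+x. ennreal (normal_density 0 \<sigma> x) * ennreal (exp (t * x)) \<partial>lborel)"
    by (subst nn_integral_density) auto
  also have "\<dots> = (\<integral>\<^sup>+x. ennreal (exp (t\<^sup>2 * \<sigma>\<^sup>2 / 2)) * ennreal (normal_density (t * \<sigma>\<^sup>2) \<sigma> x) \<partial>lborel)"
    by (intro nn_integral_cong) (simp add: ennreal_mult[symmetric] shift)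
  also have "\<dots> = ennreal (exp (t\<^sup>2 * \<sigma>\<^sup>2 / 2)) * (\<integral>\<^sup>+x. ennreal (normal_density (t * \<sigma>\<^sup>2) \<sigma> x) \<partial>lborel)"
    by (rule nn_integral_cmult) auto
  also have "(\<integral>\<^sup>+x. ennreal (normal_density (t * \<sigma>\<^sup>2) \<sigma> x) \<partial>lborel) = 1"
    using N.emeasure_space_1 by (simp add: emeasure_density)
  finally show ?thesis by simp
qed

lemma measurable_chi_density [measurable]: "chi_density d \<in> borel_measurable borel"
  unfolding chi_density_def[abs_def] by measurable

text \<open>The factor \<open>exp (u * x\<^sup>2)\<close> rescales the argument of the chi density by \<open>\<surd>(1 - 2 u)\<close>. As the total
  mass is \<open>1\<close> by assumption, the normalizing constant need not be evaluated.\<close>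

lemma nn_integral_exp_square_chi:
  assumes "prob_space (chi_distribution d)" and u: "u < 1 / 2"
  shows "(\<integral>\<^sup>+x. ennreal (exp (u * x\<^sup>2)) \<partial>chi_distribution d)
    = ennreal ((1 - 2 * u) powr (- d / 2))"
proof -
  define k where "k = sqrt (1 - 2 * u)"
  have k: "k > 0" "k\<^sup>2 = 1 - 2 * u" using u by (auto simp: k_def)
  have scale: "exp (u * x\<^sup>2) * chi_density d x = k powr (1 - d) * chi_density d (k * x)" for x
  proof (cases "x > 0")
    case False
    hence "k * x \<le> 0" using k(1) by (simp add: mult_le_0_iff)
    thus ?thesis using False by (simp add: chi_density_def)
  next
    case True
    have "k powr (1 - d) * (k * x) powr (d - 1) = x powr (d - 1)"
      using k True by (simp add: powr_mult powr_add[symmetric] mult.assoc[symmetric])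
    moreover have "exp (- (k * x)\<^sup>2 / 2) = exp (u * x\<^sup>2) * exp (- x\<^sup>2 / 2)"
      by (simp add: exp_add[symmetric] power_mult_distrib k(2) algebra_simps diff_divide_distrib)
    moreover have "\<not> k * x \<le> 0" using k True by (simp add: mult_le_0_iff)
    ultimately show ?thesis using True unfolding chi_density_def by simp
  qed
  have one: "(\<integral>\<^sup>+x. ennreal (chi_density d x) \<partial>lborel) = 1"
    using prob_space.emeasure_space_1[OF assms(1)]
    by (simp add: chi_distribution_def emeasure_density)
  have "1 = ennreal k * (\<integral>\<^sup>+x. ennreal (chi_density d (k * x)) \<partial>lborel)"
    using nn_integral_real_affine[of "\<lambda>x. ennreal (chi_density d x)" k 0] k(1) one by simp
  hence "ennreal (1 / k) * 1 = ennreal (1 / k) * ennreal k * (\<integral>\<^sup>+x. ennreal (chi_density d (k * x)) \<partial>lborel)"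
    by (simp add: mult.assoc)
  hence resc: "(\<integral>\<^sup>+x. ennreal (chi_density d (k * x)) \<partial>lborel) = ennreal (1 / k)"
    using k(1) by (simp add: ennreal_mult[symmetric])
  have "(\<integral>\<^sup>+x. ennreal (exp (u * x\<^sup>2)) \<partial>chi_distribution d)
     = (\<integral>\<^sup>+x. ennreal (chi_density d x) * ennreal (exp (u * x\<^sup>2)) \<partial>lborel)"
    unfolding chi_distribution_def by (subst nn_integral_density) auto
  also have "\<dots> = (\<integral>\<^sup>+x. ennreal (k powr (1 - d)) * ennreal (chi_density d (k * x)) \<partial>lborel)"
  proof (rule nn_integral_cong)
    fix x
    have "ennreal (exp (u * x\<^sup>2)) * ennreal (chi_density d x)
        = ennreal (k powr (1 - d)) * ennreal (chi_density d (k * x))"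
      by (simp only: ennreal_mult'[symmetric] exp_ge_zero powr_ge_zero scale)
    thus "ennreal (chi_density d x) * ennreal (exp (u * x\<^sup>2))
        = ennreal (k powr (1 - d)) * ennreal (chi_density d (k * x))" by (simp only: mult.commute)
  qed
  also have "\<dots> = ennreal (k powr (1 - d)) * ennreal (1 / k)"
    by (subst nn_integral_cmult) (auto simp: resc)
  also have "\<dots> = ennreal (k powr (1 - d) * k powr (- 1))"
    using k(1) by (simp add: ennreal_mult[symmetric] powr_minus_divide)
  also have "k powr (1 - d) * k powr (- 1) = (k powr 2) powr (- d / 2)"
    unfolding powr_add[symmetric] powr_powr by simp
  also have "k powr 2 = 1 - 2 * u" using k by simp
  finally show ?thesis .
qed

lemma AE_chi_distribution_pos: "AE x in chi_distribution d. 0 < x"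
proof -
  have "AE x in lborel. 0 < ennreal (chi_density d x) \<longrightarrow> 0 < x"
    by (rule AE_I2) (auto simp: chi_density_def)
  thus ?thesis unfolding chi_distribution_def by (subst AE_density) auto
qed

text \<open>The squares of the off-diagonal variables, centred at their mean \<open>i\<close> and divided by \<open>\<surd>N\<close>, are
  subexponential with constants that do not depend on \<open>i \<le> N\<close>.\<close>

lemma nn_integral_exp_centered_chi_square_le:
  assumes \<alpha>: "\<alpha> \<in> {1, 2 :: real}" and i: "i \<le> N" and N: "16 \<le> N" and t: "\<bar>t\<bar> \<le> 1"
    and prob: "prob_space (chi_distribution (2 * real i / \<alpha>))"
  shows "(\<integral>\<^sup>+x. ennreal (exp (t * (((x / sqrt (2 / \<alpha>))\<^sup>2 - real i) / sqrt (real N))))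
      \<partial>chi_distribution (2 * real i / \<alpha>)) \<le> ennreal (exp (4 * t\<^sup>2))"
proof -
  have \<alpha>': "1 \<le> \<alpha>" "\<alpha> \<le> 2" using \<alpha> by auto
  define w where "w = t * \<alpha> / sqrt (real N)"
  define r where "r = real i / \<alpha>"
  have sN: "4 \<le> sqrt (real N)" using N by (intro real_le_rsqrt) simp
  have r: "0 \<le> r" unfolding r_def using \<alpha>' by simp
  have w: "\<bar>w\<bar> \<le> 1 / 2"
  proof -
    have "\<bar>t\<bar> * \<alpha> \<le> 1 * 2" using t \<alpha>' by (intro mult_mono) auto
    hence "\<bar>t\<bar> * \<alpha> / sqrt (real N) \<le> 2 / 4" using sN \<alpha>' by (intro frac_le) auto
    thus ?thesis unfolding w_def using \<alpha>' by (simp add: abs_mult)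
  qed
  have integrand: "t * (((x / sqrt (2 / \<alpha>))\<^sup>2 - real i) / sqrt (real N)) = - r * w + w / 2 * x\<^sup>2" for x
  proof -
    have sq: "(x / sqrt (2 / \<alpha>))\<^sup>2 = x\<^sup>2 * \<alpha> / 2" using \<alpha>' by (simp add: power_divide)
    show ?thesis using \<alpha>' unfolding w_def r_def sq
      by (simp add: diff_divide_distrib right_diff_distrib mult_ac)
  qed
  have "(\<integral>\<^sup>+x. ennreal (exp (t * (((x / sqrt (2 / \<alpha>))\<^sup>2 - real i) / sqrt (real N))))
      \<partial>chi_distribution (2 * real i / \<alpha>))
    = (\<integral>\<^sup>+x. ennreal (exp (- r * w)) * ennreal (exp (w / 2 * x\<^sup>2)) \<partial>chi_distribution (2 * real i / \<alpha>))"
    unfolding integrand exp_add by (simp add: ennreal_mult)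
  also have "\<dots> = ennreal (exp (- r * w)) * (\<integral>\<^sup>+x. ennreal (exp (w / 2 * x\<^sup>2)) \<partial>chi_distribution (2 * real i / \<alpha>))"
    by (rule nn_integral_cmult) (simp add: chi_distribution_def)
  also have "\<dots> = ennreal (exp (- r * w)) * ennreal ((1 - 2 * (w / 2)) powr (- (2 * real i / \<alpha>) / 2))"
    using w by (subst nn_integral_exp_square_chi[OF prob]) auto
  also have "\<dots> = ennreal (exp (- r * w) * (1 - w) powr (- r))"
    unfolding r_def by (simp add: ennreal_mult)
  also have "exp (- r * w) * (1 - w) powr (- r) = exp (- r * (w + ln (1 - w)))"
    using w unfolding powr_def by (simp add: exp_add[symmetric] algebra_simps)
  also have "\<dots> \<le> exp (4 * t\<^sup>2)"
  proof -
    have "\<bar>ln (1 + (- w)) - (- w)\<bar> \<le> 2 * (- w)\<^sup>2"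
      by (rule abs_ln_one_plus_x_minus_x_bound) (use w in simp)
    hence "- (w + ln (1 - w)) \<le> 2 * w\<^sup>2" by (simp add: abs_le_iff)
    hence "r * - (w + ln (1 - w)) \<le> r * (2 * w\<^sup>2)" using r by (rule mult_left_mono)
    also have "r * (2 * w\<^sup>2) = 2 * \<alpha> * t\<^sup>2 * (real i / real N)"
      unfolding r_def w_def using \<alpha>' N by (simp add: power_divide power_mult_distrib) (simp add: power2_eq_square)
    also have "\<dots> \<le> (2 * 2 * t\<^sup>2) * 1"
      using \<alpha>' i N by (intro mult_mono mult_right_mono) auto
    finally have "- r * (w + ln (1 - w)) \<le> 4 * t\<^sup>2" by (simp only: minus_mult_commute)
    thus ?thesis by simp
  qed
  finally show ?thesis by (simp add: ennreal_leI)
qed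

text \<open>The exceptional event is measurable; outside it all interval sums of both kinds of noise are under
  control and the off-diagonal entries are positive.\<close>

lemma (in prob_space) noise_event:
  fixes a b :: "nat \<Rightarrow> 'a \<Rightarrow> real" and N :: nat and \<alpha> L :: real
  assumes \<alpha>: "\<alpha> \<in> {1, 2}" and N: "16 \<le> N"
    and ind: "indep_vars (\<lambda>_. borel) (case_sum a b) ({1..N} <+> {1..<N})"
    and a: "\<And>i. i \<in> {1..N} \<Longrightarrow> distr M borel (a i) = density lborel (normal_density 0 (sqrt \<alpha>))"
    and b: "\<And>i. i \<in> {1..<N} \<Longrightarrow>
        distr M borel (b i) = distr (chi_distribution (2 * real i / \<alpha>)) borel (\<lambda>x. x / sqrt (2 / \<alpha>))"
  obtains E where "E \<in> events" "prob E \<le> 4 * (real N + 2)\<^sup>2 * exp (4 - L)"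
    "\<And>\<omega>. \<omega> \<in> space M - E \<Longrightarrow> interval_sums_le L 1 (N + 1) (\<lambda>i. a i \<omega>)"
    "\<And>\<omega>. \<omega> \<in> space M - E \<Longrightarrow> interval_sums_le L 1 N (\<lambda>i. ((b i \<omega>)\<^sup>2 - real i) / sqrt (real N))"
    "\<And>\<omega> i. \<omega> \<in> space M - E \<Longrightarrow> i \<in> {1..<N} \<Longrightarrow> 0 < b i \<omega>"
proof -
  have \<alpha>': "1 \<le> \<alpha>" "\<alpha> \<le> 2" using \<alpha> by auto
  have ind_a: "indep_vars (\<lambda>_. borel) a {1..<N + 1}"
  proof -
    have "indep_vars (\<lambda>_. borel) (case_sum a b) (Inl ` {1..<N + 1})"
      by (rule indep_vars_subset[OF ind]) auto
    from indep_vars_reindex[OF _ this] show ?thesis by simp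
  qed
  have ind_b: "indep_vars (\<lambda>_. borel) b {1..<N}"
  proof -
    have "indep_vars (\<lambda>_. borel) (case_sum a b) (Inr ` {1..<N})"
      by (rule indep_vars_subset[OF ind]) auto
    from indep_vars_reindex[OF _ this] show ?thesis by simp
  qed
  have rv_a: "a i \<in> borel_measurable M" if "i \<in> {1..<N + 1}" for i
    using ind_a that unfolding indep_vars_def by auto
  have rv_b: "b i \<in> borel_measurable M" if "i \<in> {1..<N}" for i
    using ind_b that unfolding indep_vars_def by auto
  have meas_scale: "(\<lambda>x. x / sqrt (2 / \<alpha>)) \<in> measurable (chi_distribution d) borel" for d
    unfolding chi_distribution_def by simp
  have mgf_a: "(\<integral>\<^sup>+\<omega>. ennreal (exp (t * a i \<omega>)) \<partial>M) \<le> ennreal (exp (4 * t\<^sup>2))"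
    if i: "i \<in> {1..<N + 1}" for i t
  proof -
    have "(\<integral>\<^sup>+\<omega>. ennreal (exp (t * a i \<omega>)) \<partial>M) = (\<integral>\<^sup>+x. ennreal (exp (t * x)) \<partial>distr M borel (a i))"
      using rv_a[OF i] by (subst nn_integral_distr) auto
    also have "\<dots> = ennreal (exp (t\<^sup>2 * (sqrt \<alpha>)\<^sup>2 / 2))"
    proof -
      have "distr M borel (a i) = density lborel (normal_density 0 (sqrt \<alpha>))" using i by (intro a) auto
      thus ?thesis using \<alpha>' by (simp only:) (rule nn_integral_exp_normal, simp)
    qed
    also have "\<dots> \<le> ennreal (exp (4 * t\<^sup>2))"
    proof -
      have "t\<^sup>2 * \<alpha> \<le> t\<^sup>2 * 8" using \<alpha>' by (intro mult_left_mono) auto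
      thus ?thesis using \<alpha>' by (intro ennreal_leI) simp
    qed
    finally show ?thesis .
  qed
  have prob_chi: "prob_space (chi_distribution (2 * real i / \<alpha>))" if i: "i \<in> {1..<N}" for i
  proof
    interpret B: prob_space "distr M borel (b i)" using rv_b[OF i] by (rule prob_space_distr)
    show "emeasure (chi_distribution (2 * real i / \<alpha>)) (space (chi_distribution (2 * real i / \<alpha>))) = 1"
      using B.emeasure_space_1 unfolding b[OF i] by (subst (asm) emeasure_distr[OF meas_scale]) auto
  qed
  have mgf_b: "(\<integral>\<^sup>+\<omega>. ennreal (exp (t * (((b i \<omega>)\<^sup>2 - real i) / sqrt (real N)))) \<partial>M) \<le> ennreal (exp (4 * t\<^sup>2))"
    if i: "i \<in> {1..<N}" and t: "\<bar>t\<bar> \<le> 1" for i t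
  proof -
    have "(\<integral>\<^sup>+\<omega>. ennreal (exp (t * (((b i \<omega>)\<^sup>2 - real i) / sqrt (real N)))) \<partial>M)
        = (\<integral>\<^sup>+x. ennreal (exp (t * ((x\<^sup>2 - real i) / sqrt (real N)))) \<partial>distr M borel (b i))"
      using rv_b[OF i] by (subst nn_integral_distr) auto
    also have "\<dots> = (\<integral>\<^sup>+x. ennreal (exp (t * (((x / sqrt (2 / \<alpha>))\<^sup>2 - real i) / sqrt (real N))))
        \<partial>chi_distribution (2 * real i / \<alpha>))"
      unfolding b[OF i] by (subst nn_integral_distr[OF meas_scale]) auto
    also have "\<dots> \<le> ennreal (exp (4 * t\<^sup>2))"
      using i by (intro nn_integral_exp_centered_chi_square_le[OF \<alpha> _ N t prob_chi[OF i]]) auto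
    finally show ?thesis .
  qed
  have ind_b': "indep_vars (\<lambda>_. borel) (\<lambda>i \<omega>. ((b i \<omega>)\<^sup>2 - real i) / sqrt (real N)) {1..<N}"
    by (rule indep_vars_compose2[OF ind_b]) measurable
  obtain Ea where Ea: "Ea \<in> events" "{\<omega> \<in> space M. \<not> interval_sums_le L 1 (N + 1) (\<lambda>i. a i \<omega>)} \<subseteq> Ea"
    "prob Ea \<le> 2 * (real (N + 1) + 1)\<^sup>2 * exp (4 - L)"
    using prob_not_interval_sums_le[OF ind_a mgf_a, of L] by blast
  obtain Eb where Eb: "Eb \<in> events"
    "{\<omega> \<in> space M. \<not> interval_sums_le L 1 N (\<lambda>i. ((b i \<omega>)\<^sup>2 - real i) / sqrt (real N))} \<subseteq> Eb"
    "prob Eb \<le> 2 * (real N + 1)\<^sup>2 * exp (4 - L)"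
    using prob_not_interval_sums_le[OF ind_b' mgf_b, of L] by blast
  define Ec where "Ec = (\<Union>i\<in>{1..<N}. {\<omega> \<in> space M. b i \<omega> \<le> 0})"
  have Ec_i: "{\<omega> \<in> space M. b i \<omega> \<le> 0} \<in> null_sets M" if i: "i \<in> {1..<N}" for i
  proof -
    have "AE x in distr (chi_distribution (2 * real i / \<alpha>)) borel (\<lambda>x. x / sqrt (2 / \<alpha>)). 0 < x"
      using AE_chi_distribution_pos[of "2 * real i / \<alpha>"] \<alpha>'
      by (subst AE_distr_iff[OF meas_scale]) auto
    hence "AE x in distr M borel (b i). 0 < x" unfolding b[OF i] .
    hence "AE \<omega> in M. 0 < b i \<omega>" using rv_b[OF i] by (subst (asm) AE_distr_iff) auto
    thus ?thesis using rv_b[OF i] by (subst (asm) AE_iff_null) (auto simp: not_less)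
  qed
  have Ec: "Ec \<in> null_sets M" unfolding Ec_def using Ec_i by (intro null_sets.finite_UN) auto
  show ?thesis
  proof (rule that[of "Ea \<union> Eb \<union> Ec"])
    show "Ea \<union> Eb \<union> Ec \<in> events" using Ea(1) Eb(1) Ec by auto
    have "prob (Ea \<union> Eb \<union> Ec) \<le> prob Ea + prob Eb + prob Ec"
      using Ea(1) Eb(1) Ec by (intro order_trans[OF measure_Un_le] add_right_mono measure_Un_le) auto
    also have "prob Ec = 0" using Ec by (simp add: measure_eq_0_null_sets)
    also have "prob Ea + prob Eb + 0 \<le> 4 * (real N + 2)\<^sup>2 * exp (4 - L)"
    proof -
      define y where "y = (real N + 2)\<^sup>2 * exp (4 - L)"
      have "prob Ea \<le> 2 * y" using Ea(3) by (simp add: y_def add.commute)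
      moreover have "(real N + 1)\<^sup>2 * exp (4 - L) \<le> y"
        unfolding y_def by (intro mult_right_mono power_mono) auto
      hence "prob Eb \<le> 2 * y" using Eb(3) by simp
      ultimately show ?thesis by (simp add: y_def)
    qed
    finally show "prob (Ea \<union> Eb \<union> Ec) \<le> 4 * (real N + 2)\<^sup>2 * exp (4 - L)" .
  qed (use Ea(2) Eb(2) in \<open>auto simp: Ec_def not_le\<close>)
qed

section \<open>Comparison of the largest eigenvalues\<close>

theorem lemma5p3:
  fixes \<alpha> K :: real
    and P :: "nat \<Rightarrow> 'w measure"
    and a b :: "nat \<Rightarrow> nat \<Rightarrow> 'w \<Rightarrow> real"
    and M :: "nat \<Rightarrow> 'w \<Rightarrow> real mat"
    and l :: "nat \<Rightarrow> nat"
  assumes "\<alpha> \<in> {1, 2}"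
    and "\<And>N. prob_space (P N)"
    and "\<And>N. prob_space.indep_vars (P N) (\<lambda>_. borel)
           (case_sum (a N) (b N)) ({1..N} <+> {1..<N})"
    and "\<And>N i. i \<in> {1..N} \<Longrightarrow>
           distr (P N) borel (a N i) = density lborel (normal_density 0 (sqrt \<alpha>))"
    and "\<And>N i. i \<in> {1..<N} \<Longrightarrow>
           distr (P N) borel (b N i) =
           distr (chi_distribution (2 * real i / \<alpha>)) borel (\<lambda>x. x / sqrt (2 / \<alpha>))"
    and "\<And>N \<omega>. M N \<omega> =
           (1 / sqrt (real N)) \<cdot>\<^sub>m sym_tridiag_mat N (\<lambda>i. a N i \<omega>) (\<lambda>i. b N i \<omega>)"
    and "\<forall>\<^sub>F N in sequentially.
           2 * real N powr (1 / 3) * (ln (real N)) ^ 3 < real (l N) \<and> l N \<le> N"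
    and "K > 0"
  shows "bigo_in_prob P
           (\<lambda>N \<omega>. \<bar>largest_eigenvalue (M N \<omega>)
                   - largest_eigenvalue (bottom_right_minor (l N) (M N \<omega>))\<bar>)
           (\<lambda>N. real N powr (- K))"
  unfolding bigo_in_prob_def
proof (intro allI impI exI[of _ 1])
  \<comment> \<open>outside an event of vanishing probability the gap is at most \<open>N powr (- K)\<close>, so the constant 1
    serves for every \<open>\<epsilon>\<close>\<close>
  fix \<epsilon> :: real assume \<epsilon>: "\<epsilon> > 0"
  have "((\<lambda>N. 4 * (real N + 2)\<^sup>2 * exp (4 - 3 * ln (real N))) \<longlongrightarrow> 0) sequentially"
    by real_asymp
  hence ev_prob: "\<forall>\<^sub>F N in sequentially. 4 * (real N + 2)\<^sup>2 * exp (4 - 3 * ln (real N)) < \<epsilon>"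
    using \<epsilon> by (rule order_tendstoD(2))
  have ev1: "\<forall>\<^sub>F N in sequentially. 30 * ln (real N) \<le> real N powr (1 / 3)" by real_asymp
  have ev2: "\<forall>\<^sub>F N in sequentially. 992 * (ln (real N))\<^sup>2 + 12 * ln (real N) \<le> ln (real N) ^ 3"
    by real_asymp
  have ev3: "\<forall>\<^sub>F N in sequentially. 1 \<le> ln (real N)" by real_asymp
  have ev4: "\<forall>\<^sub>F N in sequentially.
      10 / (real N powr (1 / 3))\<^sup>2 + 18 * (ln (real N))\<^sup>2 / (real N powr (1 / 3)) ^ 3
        + 32 / (real N powr (1 / 3)) ^ 4 + 102 * ln (real N) / (real N powr (1 / 3))\<^sup>2
      \<le> (ln (real N))\<^sup>2 / (real N powr (1 / 3))\<^sup>2" by real_asymp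
  have ev5: "\<forall>\<^sub>F N in sequentially. 2 * exp (- (ln (real N) ^ 4) / 2) \<le> real N powr (- K)"
    using \<open>K > 0\<close> by real_asymp
  show "\<forall>\<^sub>F N in sequentially. measure (P N)
      {\<omega> \<in> space (P N). 1 < \<bar>\<bar>largest_eigenvalue (M N \<omega>)
          - largest_eigenvalue (bottom_right_minor (l N) (M N \<omega>))\<bar> / real N powr (- K)\<bar>} < \<epsilon>"
    using ev_prob ev1 ev2 ev3 ev4 ev5 assms(7) eventually_ge_at_top[of 16]
  proof eventually_elim
    case (elim N)
    define L where "L = ln (real N)"
    define s where "s = real N powr (1 / 3)"
    define r where "r = sqrt (real N)"
    have r: "0 < r" "r\<^sup>2 = real N" using elim(8) by (auto simp: r_def)
    have s3: "s ^ 3 = real N" unfolding s_def using elim(8) by (simp add: powr_power)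
    interpret PN: prob_space "P N" by (rule assms(2))
    obtain E where E: "E \<in> PN.events" "PN.prob E \<le> 4 * (real N + 2)\<^sup>2 * exp (4 - 3 * L)"
      and E_a: "\<And>\<omega>. \<omega> \<in> space (P N) - E \<Longrightarrow> interval_sums_le (3 * L) 1 (N + 1) (\<lambda>i. a N i \<omega>)"
      and E_b: "\<And>\<omega>. \<omega> \<in> space (P N) - E \<Longrightarrow>
          interval_sums_le (3 * L) 1 N (\<lambda>i. ((b N i \<omega>)\<^sup>2 - real i) / sqrt (real N))"
      and E_pos: "\<And>\<omega> i. \<omega> \<in> space (P N) - E \<Longrightarrow> i \<in> {1..<N} \<Longrightarrow> 0 < b N i \<omega>"
      using PN.noise_event[OF assms(1) elim(8) assms(3) assms(4) assms(5), of "3 * L"] by blast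
    have gap: "\<bar>largest_eigenvalue (M N \<omega>) - largest_eigenvalue (bottom_right_minor (l N) (M N \<omega>))\<bar>
        \<le> real N powr (- K)" if \<omega>: "\<omega> \<in> space (P N) - E" for \<omega>
    proof -
      define A where "A i = 1 / r * a N i \<omega>" for i
      define B where "B i = (if i = 0 then 0 else 1 / r * b N i \<omega>)" for i
      define f where "f i = (if i = 0 then 0 else 1 / r * (((b N i \<omega>)\<^sup>2 - real i) / r))" for i
      have M: "M N \<omega> = sym_tridiag_mat N A B"
        unfolding assms(6) smult_sym_tridiag_mat r_def[symmetric]
        by (rule sym_tridiag_mat_cong) (auto simp: A_def B_def)
      have B_f: "(B i)\<^sup>2 = real i / real N + f i" for i
        using r unfolding B_def f_def r(2)[symmetric]
        by (simp add: power_mult_distrib power_divide power2_eq_square field_simps)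
      have \<sigma>: "1 / r * (3 * L) = 3 * L / sqrt (real N)" by (simp add: r_def)
      have A_sums: "interval_sums_le (3 * L / sqrt (real N)) 1 (N + 1) A"
        using interval_sums_le_cmult[OF _ E_a[OF \<omega>], of "1 / r"] r
        unfolding A_def[abs_def] \<sigma> by simp
      have "interval_sums_le (3 * L / sqrt (real N)) 1 N f"
        using interval_sums_le_cmult[OF _ E_b[OF \<omega>], of "1 / r"] r
        unfolding \<sigma> r_def[symmetric]
        by (subst interval_sums_le_cong[of _ _ f]) (auto simp: f_def)
      hence f_sums: "interval_sums_le (3 * L / sqrt (real N)) 0 N f"
        using elim(4) by (intro interval_sums_le_extend_zero) (auto simp: f_def L_def)
      have B_pos: "0 < B i" if "i \<in> {1..<N}" for i
        using E_pos[OF \<omega> that] that r by (simp add: B_def)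
      have "\<bar>largest_eigenvalue (M N \<omega>) - largest_eigenvalue (bottom_right_minor (l N) (M N \<omega>))\<bar>
          \<le> 2 * exp (- (L ^ 4) / 2)"
        unfolding M using elim(7)
        by (subst bottom_right_minor_sym_tridiag_mat, simp,
            intro trailing_gap_of_good_noise[where s = s and f = f, OF s3 _ _ _ _ _ _ _ B_pos B_f refl A_sums f_sums])
           (use elim in \<open>simp_all add: L_def s_def B_def\<close>)
      also have "\<dots> \<le> real N powr (- K)" unfolding L_def by (rule elim(6))
      finally show ?thesis .
    qed
    define Z where "Z = {\<omega> \<in> space (P N). 1 < \<bar>\<bar>largest_eigenvalue (M N \<omega>)
          - largest_eigenvalue (bottom_right_minor (l N) (M N \<omega>))\<bar> / real N powr (- K)\<bar>}"
    have "Z \<subseteq> E"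
    proof
      fix \<omega> assume \<omega>: "\<omega> \<in> Z"
      show "\<omega> \<in> E"
      proof (rule ccontr)
        assume "\<omega> \<notin> E"
        hence "\<bar>largest_eigenvalue (M N \<omega>) - largest_eigenvalue (bottom_right_minor (l N) (M N \<omega>))\<bar>
          \<le> real N powr (- K)" using \<omega> by (intro gap) (auto simp: Z_def)
        moreover have "0 < real N powr (- K)" using elim(8) by simp
        ultimately show False using \<omega> unfolding Z_def by (simp add: divide_le_eq less_divide_eq)
      qed
    qed
    have "measure (P N) Z \<le> PN.prob E"
      \<comment> \<open>measurability of \<open>Z\<close> is not needed: the outer set \<open>E\<close> is measurable\<close>
      using PN.finite_measure_mono[OF \<open>Z \<subseteq> E\<close> E(1)] .
    also have "\<dots> < \<epsilon>" using E(2) elim(1) unfolding L_def by simp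
    finally show ?case unfolding Z_def .
  qed
qed

end
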